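(* Let $\mathbf{p}\in\mathbb{N}^n$. Then $d_0^{\mathbf{p}}$ is a critical value of $I_0^{\mathbf{p}}$ on $\Lambda_0^{\mathbf{p}}$, with a corresponding critical point $u_{\mathbf{p}}$ (i.e. $(I_0^{\mathbf{p}})'(u_{\mathbf{p}})=0$ and $I_0^{\mathbf{p}}(u_{\mathbf{p}})=d_0^{\mathbf{p}}$) satisfying $0<u_{\mathbf{p}}<w_0-v_0$, and $u_{\mathbf{p}}+v_0$ is a solution of $(E)$.
   Context: Let $n,r\in\mathbb{N}=\{1,2,\dots\}$. For $\mathbf{i}\in\mathbb{Z}^n$ put $\|\mathbf{i}\|=\sum_{j=1}^n|\mathbf{i}_j|$ and $B=\{\mathbf{k}\in\mathbb{Z}^n:\|\mathbf{k}\|\le r\}$. Let $s\in C^2(\mathbb{R}^B,\mathbb{R})$ satisfy: (S1) $s(u+1_B)=s(u)$, $1_B$ being the constant function $1$ on $B$; (S2) $s$ is bounded from below and $\lim_{|u(\mathbf{k})-u(\mathbf{j})|\to\infty}s(u)=\infty$ for all $\mathbf{k},\mathbf{j}\in B$ with $\|\mathbf{k}-\mathbf{j}\|=1$; (S3) $\partial_{\mathbf{k},\mathbf{j}}s\le 0$ for $\mathbf{k},\mathbf{j}\in B$, $\mathbf{k}\ne\mathbf{j}$, and $\partial_{\mathbf{0},\mathbf{j}}s<0$ for $\|\mathbf{j}\|=1$; (S4) there is a constant $C$ with $|\partial_{\mathbf{i},\mathbf{k}}s|\le C$ for all $\mathbf{i},\mathbf{k}\in B$. For $u:\mathbb{Z}^n\to\mathbb{R}$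 and $\mathbf{j}\in\mathbb{Z}^n$ let $S_{\mathbf{j}}(u)=s\big((u(\mathbf{j}+\mathbf{k}))_{\mathbf{k}\in B}\big)$, and let $\partial_{\mathbf{i}}S_{\mathbf{j}}$ be the partial derivative with respect to $u(\mathbf{i})$. A solution of $(E)$ is a function $u:\mathbb{Z}^n\to\mathbb{R}$ with $\sum_{\mathbf{j}:\|\mathbf{j}-\mathbf{i}\|\le r}\partial_{\mathbf{i}}S_{\mathbf{j}}(u)=0$ for all $\mathbf{i}\in\mathbb{Z}^n$. Inequalities $<,\le$ between functions are pointwise at every point of $\mathbb{Z}^n$. Let $c_0$ be the infimum of $S_{\mathbf{0}}$ over the constant functions on $\mathbb{Z}^n$ and $\mathcal{M}_0$ the set of constant functions $u$ with $S_{\mathbf{0}}(u)=c_0$. Assume there are $v_0,w_0\in\mathcal{M}_0$ with $v_0<w_0$ that are adjacent, i.e. there is no $u\in\mathcal{M}_0$ with $v_0<u<w_0$; fix such $v_0,w_0$. For $\mathbf{p}\in\mathbb{N}^n$ let $\Lambda_0^{\mathbf{p}}$ be the space of $u:\mathbb{Z}^n\to\mathbb{R}$ with $u(\mathbf{i}+\mathbf{p}_j\mathbf{e}_j)=u(\mathbf{i})$ for all $\mathbf{i}$ and $1\le j\le n$ ($\mathbf{e}_j$ the standard basis), let $\mathbb{T}_0^{\mathbf{p}}=\prod_{j=1}^n\{0,\dots,\mathbf{p}_j-1\}$ and $\|u\|_{\Lambda_0^{\mathbf{p}}}^2=\sum_{\mathbf{j}\in\mathbb{T}_0^{\mathbf{p}}}|u(\mathbf{j})|^2$.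 Put $J_0^{\mathbf{p}}(u)=\sum_{\mathbf{j}\in\mathbb{T}_0^{\mathbf{p}}}S_{\mathbf{j}}(u)$ and $I_0^{\mathbf{p}}(u)=J_0^{\mathbf{p}}(u+v_0)$ for $u\in\Lambda_0^{\mathbf{p}}$; $(I_0^{\mathbf{p}})'$ is the Fréchet derivative. Let $\mathcal{G}_0^{\mathbf{p}}=\{u\in\Lambda_0^{\mathbf{p}}:0\le u\le w_0-v_0\}$, $\mathcal{H}_0^{\mathbf{p}}=\{h\in C([0,1],\mathcal{G}_0^{\mathbf{p}}):h(0)=0,\ h(1)=w_0-v_0\}$ and $d_0^{\mathbf{p}}=\inf_{h\in\mathcal{H}_0^{\mathbf{p}}}\max_{\theta\in[0,1]}I_0^{\mathbf{p}}(h(\theta))$. *)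

theory Defs
  imports "HOL-Analysis.Analysis"
begin

definition znorm :: "int ^ 'n \<Rightarrow> int" where
  "znorm i = (\<Sum>j\<in>UNIV. \<bar>i $ j\<bar>)"

definition B :: "nat \<Rightarrow> (int ^ 'n) set" where
  "B r = {k. znorm k \<le> int r}"

text \<open>For finite \<open>A\<close>, the space of real functions on \<open>A\<close> is \<open>extensional A\<close>, with the
  topology inherited from the product topology of the function type. The partial derivative
  below is used both on \<open>extensional A\<close> and for functionals of \<open>u : \<int>\<^sup>n \<rightarrow> \<real>\<close>.\<close>

definition partial :: "'a \<Rightarrow> (('a \<Rightarrow> real) \<Rightarrow> real) \<Rightarrow> ('a \<Rightarrow> real) \<Rightarrow> real" where
  "partial k f u = deriv (\<lambda>t. f (u(k := t))) (u k)"

abbreviation partial2 :: "'a \<Rightarrow> 'a \<Rightarrow> (('a \<Rightarrow> real) \<Rightarrow> real) \<Rightarrow> ('a \<Rightarrow> real) \<Rightarrow> real" where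
  "partial2 k j f \<equiv> partial k (partial j f)"

definition C1_on :: "'a set \<Rightarrow> (('a \<Rightarrow> real) \<Rightarrow> real) \<Rightarrow> bool" where
  "C1_on A f \<longleftrightarrow> continuous_on (extensional A) f \<and>
     (\<forall>k\<in>A. (\<forall>u\<in>extensional A. (\<lambda>t. f (u(k := t))) differentiable at (u k)) \<and>
             continuous_on (extensional A) (partial k f))"

definition C2_on :: "'a set \<Rightarrow> (('a \<Rightarrow> real) \<Rightarrow> real) \<Rightarrow> bool" where
  "C2_on A f \<longleftrightarrow> C1_on A f \<and> (\<forall>k\<in>A. C1_on A (partial k f))"

definition cond_S1 :: "nat \<Rightarrow> ((int ^ 'n \<Rightarrow> real) \<Rightarrow> real) \<Rightarrow> bool" where
  "cond_S1 r s \<longleftrightarrow> (\<forall>u\<in>extensional (B r). s (\<lambda>k\<in>B r. u k + 1) = s u)"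

definition cond_S2 :: "nat \<Rightarrow> ((int ^ 'n \<Rightarrow> real) \<Rightarrow> real) \<Rightarrow> bool" where
  "cond_S2 r s \<longleftrightarrow> bdd_below (s ` extensional (B r)) \<and>
     (\<forall>k\<in>B r. \<forall>j\<in>B r. znorm (k - j) = 1 \<longrightarrow>
        filterlim s at_top
          (inf (filtercomap (\<lambda>u. \<bar>u k - u j\<bar>) at_top) (principal (extensional (B r)))))"

definition cond_S3 :: "nat \<Rightarrow> ((int ^ 'n \<Rightarrow> real) \<Rightarrow> real) \<Rightarrow> bool" where
  "cond_S3 r s \<longleftrightarrow>
     (\<forall>u\<in>extensional (B r). \<forall>k\<in>B r. \<forall>j\<in>B r. k \<noteq> j \<longrightarrow> partial2 k j s u \<le> 0) \<and>
     (\<forall>u\<in>extensional (B r). \<forall>j. znorm j = 1 \<longrightarrow> partial2 0 j s u < 0)"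

definition cond_S4 :: "nat \<Rightarrow> ((int ^ 'n \<Rightarrow> real) \<Rightarrow> real) \<Rightarrow> bool" where
  "cond_S4 r s \<longleftrightarrow>
     (\<exists>C. \<forall>u\<in>extensional (B r). \<forall>i\<in>B r. \<forall>k\<in>B r. \<bar>partial2 i k s u\<bar> \<le> C)"

definition S :: "nat \<Rightarrow> ((int ^ 'n \<Rightarrow> real) \<Rightarrow> real) \<Rightarrow> int ^ 'n \<Rightarrow> (int ^ 'n \<Rightarrow> real) \<Rightarrow> real" where
  "S r s j u = s (\<lambda>k\<in>B r. u (j + k))"

definition solution :: "nat \<Rightarrow> ((int ^ 'n \<Rightarrow> real) \<Rightarrow> real) \<Rightarrow> (int ^ 'n \<Rightarrow> real) \<Rightarrow> bool" where
  "solution r s u \<longleftrightarrow> (\<forall>i. (\<Sum>j | znorm (j - i) \<le> int r. partial i (S r s j) u) = 0)"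

definition c0 :: "nat \<Rightarrow> ((int ^ 'n \<Rightarrow> real) \<Rightarrow> real) \<Rightarrow> real" where
  "c0 r s = (INF c. S r s 0 (\<lambda>_. c))"

definition M0 :: "nat \<Rightarrow> ((int ^ 'n \<Rightarrow> real) \<Rightarrow> real) \<Rightarrow> (int ^ 'n \<Rightarrow> real) set" where
  "M0 r s = {u. (\<exists>c. u = (\<lambda>_. c)) \<and> S r s 0 u = c0 r s}"

text \<open>Pointwise strict order; the strict order of the function type is weaker.\<close>

definition below :: "('a \<Rightarrow> real) \<Rightarrow> ('a \<Rightarrow> real) \<Rightarrow> bool"  (infix "\<lless>" 50) where
  "u \<lless> v \<longleftrightarrow> (\<forall>i. u i < v i)"

definition Lam :: "nat ^ 'n \<Rightarrow> (int ^ 'n \<Rightarrow> real) set" where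
  "Lam p = {u. \<forall>i j. u (i + axis j (int (p $ j))) = u i}"

definition T0 :: "nat ^ 'n \<Rightarrow> (int ^ 'n) set" where
  "T0 p = {i. \<forall>j. 0 \<le> i $ j \<and> i $ j < int (p $ j)}"

definition Lam_norm :: "nat ^ 'n \<Rightarrow> (int ^ 'n \<Rightarrow> real) \<Rightarrow> real" where
  "Lam_norm p u = L2_set u (T0 p)"

definition Lam_topology :: "nat ^ 'n \<Rightarrow> (int ^ 'n \<Rightarrow> real) topology" where
  "Lam_topology p = Metric_space.mtopology (Lam p) (\<lambda>u v. Lam_norm p (\<lambda>i. u i - v i))"

text \<open>Frechet derivative on the normed space \<open>Lam p\<close>, which is not a type of its own.\<close>

definition has_frechet_derivative ::
  "nat ^ 'n \<Rightarrow> ((int ^ 'n \<Rightarrow> real) \<Rightarrow> real) \<Rightarrow> ((int ^ 'n \<Rightarrow> real) \<Rightarrow> real) \<Rightarrow> (int ^ 'n \<Rightarrow> real) \<Rightarrow> bool"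
where
  "has_frechet_derivative p F L u \<longleftrightarrow>
     (\<forall>x\<in>Lam p. \<forall>y\<in>Lam p. \<forall>a b. L (\<lambda>i. a * x i + b * y i) = a * L x + b * L y) \<and>
     (\<exists>K. \<forall>x\<in>Lam p. \<bar>L x\<bar> \<le> K * Lam_norm p x) \<and>
     (\<forall>e>0. \<exists>d>0. \<forall>x\<in>Lam p. Lam_norm p x < d \<longrightarrow>
        \<bar>F (\<lambda>i. u i + x i) - F u - L x\<bar> \<le> e * Lam_norm p x)"

definition critical_point ::
  "nat ^ 'n \<Rightarrow> ((int ^ 'n \<Rightarrow> real) \<Rightarrow> real) \<Rightarrow> (int ^ 'n \<Rightarrow> real) \<Rightarrow> bool"
where
  "critical_point p F u \<longleftrightarrow> u \<in> Lam p \<and> has_frechet_derivative p F (\<lambda>_. 0) u"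

definition J0 ::
  "nat \<Rightarrow> ((int ^ 'n \<Rightarrow> real) \<Rightarrow> real) \<Rightarrow> nat ^ 'n \<Rightarrow> (int ^ 'n \<Rightarrow> real) \<Rightarrow> real"
where
  "J0 r s p u = (\<Sum>j\<in>T0 p. S r s j u)"

definition I0 ::
  "nat \<Rightarrow> ((int ^ 'n \<Rightarrow> real) \<Rightarrow> real) \<Rightarrow> (int ^ 'n \<Rightarrow> real) \<Rightarrow> nat ^ 'n \<Rightarrow> (int ^ 'n \<Rightarrow> real) \<Rightarrow> real"
where
  "I0 r s v0 p u = J0 r s p (\<lambda>i. u i + v0 i)"

definition G0 :: "(int ^ 'n \<Rightarrow> real) \<Rightarrow> (int ^ 'n \<Rightarrow> real) \<Rightarrow> nat ^ 'n \<Rightarrow> (int ^ 'n \<Rightarrow> real) set" where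
  "G0 v0 w0 p = {u \<in> Lam p. \<forall>i. 0 \<le> u i \<and> u i \<le> w0 i - v0 i}"

definition H0 ::
  "(int ^ 'n \<Rightarrow> real) \<Rightarrow> (int ^ 'n \<Rightarrow> real) \<Rightarrow> nat ^ 'n \<Rightarrow> (real \<Rightarrow> int ^ 'n \<Rightarrow> real) set"
where
  "H0 v0 w0 p =
     {h. continuous_map (top_of_set {0..1}) (subtopology (Lam_topology p) (G0 v0 w0 p)) h \<and>
         h 0 = (\<lambda>_. 0) \<and> h 1 = (\<lambda>i. w0 i - v0 i)}"

text \<open>The inner supremum is over a continuous function on \<open>[0,1]\<close>, so it is a maximum;
  \<open>Max\<close> is only meaningful on finite sets.\<close>

definition d0 ::
  "nat \<Rightarrow> ((int ^ 'n \<Rightarrow> real) \<Rightarrow> real) \<Rightarrow> (int ^ 'n \<Rightarrow> real) \<Rightarrow> (int ^ 'n \<Rightarrow> real) \<Rightarrow> nat ^ 'n \<Rightarrow> real"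
where
  "d0 r s v0 w0 p = (INF h\<in>H0 v0 w0 p. SUP \<theta>\<in>{0..1}. I0 r s v0 p (h \<theta>))"

end

theory Submission
  imports Defs
begin

text \<open>
  The functional \<open>J0 r s p\<close> lives on the finite-dimensional space of periodic functions, and the
  critical point is a mountain pass between its two adjacent minimizers \<open>v0\<close> and \<open>w0\<close>. What makes
  the argument work inside the order interval \<open>v0 \<le> u \<le> w0\<close> is the twist condition (S3).

  The equation \<open>(E)\<close> at the site \<open>i\<close> says that \<open>gradient r s i u = 0\<close>, and on periodic functions
  \<open>gradient r s i\<close> is the derivative of \<open>J0 r s p\<close> in the direction of the \<open>i\<close>-th coordinate. By
  (S3) and (S4), raising \<open>u\<close> to \<open>v\<close> increases the gradient at \<open>i\<close> by at most a constant times
  \<open>v i - u i\<close> (\<open>gradient_upper\<close>), and if \<open>u\<close> and \<open>v\<close> agree at \<open>i\<close> but not at a neighbour of \<open>i\<close>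
  the gradient strictly drops (\<open>gradient_strict\<close>). Two consequences carry the proof.

  One step \<open>descend u = u - \<tau> * gradient u\<close> of gradient descent with a small step size is
  order preserving, hence maps the interval between two solutions to itself, and it lowers \<open>J0 r s p\<close>
  by a multiple of the squared gradient (\<open>descend_mono\<close>, \<open>descend_decreases\<close>). This one map
  replaces the negative gradient flow: no differential equation has to be solved. Since the order
  interval is compact, a minimax level of paths in it whose ends are fixed by the descent map is
  attained at a point with vanishing gradient (\<open>minimax_critical_point\<close>): otherwise composing a
  nearly optimal path with the map would push it below the level.

  Two ordered solutions which touch at one site are equal, because touching spreads to
  neighbours and the lattice is connected (\<open>strong_comparison\<close>).

  The level lies strictly above the minimum. Indeed a minimizer \<open>u\<close> in the interval is critical;
  submodularity of the potential makes the maximum of \<open>u\<close> and any translate of \<open>u\<close> a minimizer as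
  well; strong comparison orders \<open>u\<close> and the translate, and as both have the same sum over a period
  cell they coincide. So minimizers are constant, and by adjacency they are \<open>v0\<close> and \<open>w0\<close>
  (\<open>minimizer_ends\<close>). Every path has to cross the compact slice where \<open>u 0\<close> is the midpoint of
  \<open>v0\<close> and \<open>w0\<close>, where the functional is bounded away from its minimum. Therefore the critical
  point found at the minimax level differs from \<open>v0\<close> and \<open>w0\<close>, and strong comparison puts it
  strictly between them.
\<close>

section \<open>The lattice\<close>

lemma znorm_axis: "znorm (axis c a) = \<bar>a\<bar>"
proof -
  have "(\<Sum>j\<in>UNIV. \<bar>axis c a $ j\<bar>) = (\<Sum>j\<in>UNIV. if j = c then \<bar>a\<bar> else 0)"
    by (intro sum.cong) (auto simp: axis_def)
  then show ?thesis by (simp add: znorm_def)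
qed

lemma znorm_minus: "znorm (- k) = znorm k"
  by (simp add: znorm_def)

lemma znorm_diff_sgn:
  assumes "d $ c \<noteq> 0"
  shows "znorm (d - axis c (sgn (d $ c))) = znorm d - 1"
proof -
  have "znorm (d - axis c (sgn (d $ c))) = \<bar>d $ c - sgn (d $ c)\<bar> + (\<Sum>j\<in>UNIV - {c}. \<bar>d $ j\<bar>)"
    unfolding znorm_def by (subst sum.remove[of _ c]) (auto simp: axis_def intro!: sum.cong)
  moreover have "znorm d = \<bar>d $ c\<bar> + (\<Sum>j\<in>UNIV - {c}. \<bar>d $ j\<bar>)"
    unfolding znorm_def by (subst sum.remove[of _ c]) auto
  moreover have "\<bar>d $ c - sgn (d $ c)\<bar> = \<bar>d $ c\<bar> - 1"
    using assms by (auto simp: sgn_if abs_if)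
  ultimately show ?thesis by simp
qed

text \<open>Subtracting a unit vector in a direction where \<open>i - j\<close> is nonzero brings \<open>i\<close> one step closer
  to \<open>j\<close>.\<close>

lemma lattice_connected:
  assumes "P i" and step: "\<And>i k. P i \<Longrightarrow> znorm k = 1 \<Longrightarrow> P (i - k)"
  shows "P j"
proof -
  have "P i \<Longrightarrow> znorm (i - j) = int n \<Longrightarrow> P j" for n i
  proof (induction n arbitrary: i)
    case 0
    then have "i - j = 0"
      by (simp add: znorm_def sum_nonneg_eq_0_iff vec_eq_iff)
    with 0 show ?case by simp
  next
    case (Suc n)
    have "\<exists>c. (i - j) $ c \<noteq> 0"
    proof (rule ccontr)
      assume "\<not> ?thesis"
      then have "znorm (i - j) = 0" by (simp add: znorm_def)
      with Suc.prems show False by simp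
    qed
    then obtain c where c: "(i - j) $ c \<noteq> 0" by blast
    let ?k = "axis c (sgn ((i - j) $ c))"
    have "znorm ?k = 1" using c by (simp add: znorm_axis)
    then have "P (i - ?k)" using step Suc.prems by blast
    moreover have shift: "i - ?k - j = i - j - ?k" by (simp add: algebra_simps)
    have "znorm (i - ?k - j) = int n"
      unfolding shift using znorm_diff_sgn[OF c] Suc.prems by simp
    ultimately show ?case by (rule Suc.IH)
  qed
  moreover have "znorm (i - j) = int (nat (znorm (i - j)))"
    by (simp add: znorm_def sum_nonneg)
  ultimately show ?thesis using \<open>P i\<close> by blast
qed

lemma finite_box: "finite {k :: int ^ 'n. \<forall>j. k $ j \<in> M j}" if "\<And>j. finite (M j)"
proof -
  have "vec_nth ` {k :: int ^ 'n. \<forall>j. k $ j \<in> M j} \<subseteq> PiE UNIV M" by auto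
  moreover have "finite (PiE UNIV M)" using that by (intro finite_PiE) auto
  ultimately have "finite (vec_nth ` {k :: int ^ 'n. \<forall>j. k $ j \<in> M j})"
    using finite_subset by blast
  then show ?thesis by (rule finite_imageD) (simp add: inj_on_def vec_nth_inject)
qed

lemma finite_B: "finite (B r :: (int ^ 'n) set)"
proof (rule finite_subset)
  show "B r \<subseteq> {k :: int ^ 'n. \<forall>j. k $ j \<in> {- int r..int r}}"
  proof safe
    fix k :: "int ^ 'n" and j assume "k \<in> B r"
    moreover have "\<bar>k $ j\<bar> \<le> znorm k"
      unfolding znorm_def by (rule member_le_sum) auto
    ultimately show "k $ j \<in> {- int r..int r}" by (auto simp: B_def)
  qed
  show "finite {k :: int ^ 'n. \<forall>j. k $ j \<in> {- int r..int r}}" by (rule finite_box) simp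
qed

lemma zero_in_B: "0 \<in> B r"
  by (simp add: B_def znorm_def)

section \<open>Functions of finitely many variables\<close>

text \<open>Passing from \<open>y\<close> to \<open>z\<close> one coordinate at a time reduces estimates for functions of several
  variables to one-variable ones. All intermediate points \<open>w\<close> are mixtures of \<open>y\<close> and \<open>z\<close>, which
  keeps them in the box spanned by \<open>y\<close> and \<open>z\<close>.\<close>

lemma telescope_le:
  fixes g :: "('a \<Rightarrow> real) \<Rightarrow> real"
  assumes "finite A" "y \<in> extensional A" "z \<in> extensional A"
    and step: "\<And>l w. l \<in> A \<Longrightarrow> w \<in> extensional A \<Longrightarrow> (\<And>m. w m = y m \<or> w m = z m) \<Longrightarrow>
      g (w(l := z l)) - g (w(l := y l)) \<le> b l"
  shows "g z - g y \<le> sum b A"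
proof -
  define mix where "mix D = (\<lambda>l. if l \<in> D then z l else y l)" for D
  have "g (mix D) - g y \<le> sum b D" if "D \<subseteq> A" for D
    using finite_subset[OF that \<open>finite A\<close>] that
  proof (induction D rule: finite_induct)
    case empty
    then show ?case by (simp add: mix_def)
  next
    case (insert l D)
    have "mix D \<in> extensional A"
      using assms(2,3) by (auto simp: mix_def extensional_def)
    then have "g ((mix D)(l := z l)) - g ((mix D)(l := y l)) \<le> b l"
      using insert.prems by (intro step) (auto simp: mix_def)
    moreover have "(mix D)(l := z l) = mix (insert l D)" "(mix D)(l := y l) = mix D"
      using insert.hyps by (auto simp: mix_def fun_eq_iff)
    ultimately show ?case using insert by simp
  qed
  moreover have "mix A = z"
    using assms(2,3) by (auto simp: mix_def fun_eq_iff extensional_def)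
  ultimately show ?thesis by (metis order_refl)
qed

lemma telescope_abs:
  fixes g :: "('a \<Rightarrow> real) \<Rightarrow> real"
  assumes A: "finite A" "y \<in> extensional A" "z \<in> extensional A"
    and step: "\<And>l w. l \<in> A \<Longrightarrow> w \<in> extensional A \<Longrightarrow> (\<And>m. w m = y m \<or> w m = z m) \<Longrightarrow>
      \<bar>g (w(l := z l)) - g (w(l := y l)) - a l\<bar> \<le> b l"
  shows "\<bar>g z - g y - sum a A\<bar> \<le> sum b A"
proof -
  have "g z - g y \<le> (\<Sum>l\<in>A. a l + b l)"
  proof (rule telescope_le[OF A])
    fix l w assume "l \<in> A" "w \<in> extensional A" "\<And>m. w m = y m \<or> w m = z m"
    from step[OF this] show "g (w(l := z l)) - g (w(l := y l)) \<le> a l + b l" by linarith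
  qed
  moreover have "(- g z) - (- g y) \<le> (\<Sum>l\<in>A. b l - a l)"
  proof (rule telescope_le[OF A])
    fix l w assume "l \<in> A" "w \<in> extensional A" "\<And>m. w m = y m \<or> w m = z m"
    from step[OF this] show "- g (w(l := z l)) - (- g (w(l := y l))) \<le> b l - a l" by linarith
  qed
  ultimately show ?thesis by (simp add: sum.distrib sum_subtractf abs_le_iff)
qed

lemma fun_upd_extensional: "y \<in> extensional A \<Longrightarrow> k \<in> A \<Longrightarrow> y(k := t) \<in> extensional A"
  by (auto simp: extensional_def)

lemma C1_on_has_derivative:
  assumes "C1_on A f" "y \<in> extensional A" "k \<in> A"
  shows "((\<lambda>t. f (y(k := t))) has_real_derivative partial k f (y(k := t))) (at t)"
proof -
  have "y(k := t) \<in> extensional A" using assms by (auto intro: fun_upd_extensional)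
  then have "(\<lambda>\<tau>. f ((y(k := t))(k := \<tau>))) differentiable at ((y(k := t)) k)"
    using assms unfolding C1_on_def by blast
  then show ?thesis
    unfolding partial_def using DERIV_deriv_iff_real_differentiable by auto
qed

lemma has_real_derivative_quadratic_remainder:
  fixes f :: "real \<Rightarrow> real"
  assumes "\<And>h. \<bar>f (t + h) - f t - h * D\<bar> \<le> K * h\<^sup>2"
  shows "(f has_real_derivative D) (at t)"
proof -
  have "((\<lambda>h. (f (t + h) - f t) / h - D) \<longlongrightarrow> 0) (at 0)"
  proof (rule Lim_null_comparison)
    show "\<forall>\<^sub>F h in at 0. norm ((f (t + h) - f t) / h - D) \<le> K * \<bar>h\<bar>"
    proof (rule eventually_mono[OF eventually_at_ball'[of 1]])
      fix h :: real assume "h \<in> ball 0 1 \<and> h \<noteq> 0 \<and> h \<in> UNIV"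
      then have "h \<noteq> 0" by simp
      then have "(f (t + h) - f t) / h - D = (f (t + h) - f t - h * D) / h"
        by (simp add: field_simps)
      moreover have "\<bar>(f (t + h) - f t - h * D) / h\<bar> \<le> K * h\<^sup>2 / \<bar>h\<bar>"
        using assms[of h] by (simp add: divide_right_mono)
      moreover have "K * h\<^sup>2 / \<bar>h\<bar> = K * \<bar>h\<bar>"
        using \<open>h \<noteq> 0\<close> by (simp add: power2_eq_square field_simps)
      ultimately show "norm ((f (t + h) - f t) / h - D) \<le> K * \<bar>h\<bar>" by simp
    qed simp
    show "((\<lambda>h. K * \<bar>h\<bar>) \<longlongrightarrow> 0) (at (0::real))"
      using tendsto_mult_right_zero[OF tendsto_rabs_zero[OF tendsto_ident_at]] by auto
  qed
  then show ?thesis by (simp add: DERIV_def LIM_zero_iff)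
qed

section \<open>Periodic functions\<close>

definition reduce :: "nat ^ 'n \<Rightarrow> int ^ 'n \<Rightarrow> int ^ 'n" where
  "reduce p i = (\<chi> j. i $ j mod int (p $ j))"

lemma finite_T0: "finite (T0 p :: (int ^ 'n) set)"
proof -
  have "T0 p = {i :: int ^ 'n. \<forall>j. i $ j \<in> {0..<int (p $ j)}}" by (auto simp: T0_def)
  then show ?thesis using finite_box[of "\<lambda>j. {0..<int (p $ j)}"] by simp
qed

lemma Lam_multiple:
  fixes p :: "nat ^ 'n"
  assumes "u \<in> Lam p" shows "u (i + axis j (m * int (p $ j))) = u i"
proof -
  have 1: "u (i + axis j (int m * int (p $ j))) = u i" for m i
  proof (induction m)
    case 0
    have "i + axis j (int 0 * int (p $ j)) = i" by (simp add: axis_def vec_eq_iff)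
    then show ?case by (rule arg_cong)
  next
    case (Suc m)
    have "i + axis j (int (Suc m) * int (p $ j))
        = (i + axis j (int m * int (p $ j))) + axis j (int (p $ j))"
      by (auto simp: vec_eq_iff axis_def distrib_right)
    also have "u \<dots> = u (i + axis j (int m * int (p $ j)))"
      using assms unfolding Lam_def by blast
    finally show ?case using Suc by simp
  qed
  show ?thesis
  proof (cases "m \<ge> 0")
    case True
    then show ?thesis using 1[of i "nat m"] by simp
  next
    case False
    then have "(i + axis j (m * int (p $ j))) + axis j (int (nat (- m)) * int (p $ j)) = i"
      by (auto simp: vec_eq_iff axis_def)
    with 1[of "i + axis j (m * int (p $ j))" "nat (- m)"] show ?thesis by metis
  qed
qed

lemma Lam_reduce:
  assumes "u \<in> Lam p" shows "u (reduce p i) = u i"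
proof -
  have "u (\<chi> j. if j \<in> D then i $ j mod int (p $ j) else i $ j) = u i" if "finite D" for D
    using that
  proof (induction D rule: finite_induct)
    case empty
    have "(\<chi> j. i $ j) = i" by (simp add: vec_eq_iff)
    then show ?case by simp
  next
    case (insert a D)
    let ?v = "\<lambda>D. (\<chi> j. if j \<in> D then i $ j mod int (p $ j) else i $ j)"
    have "?v D = ?v (insert a D) + axis a ((i $ a div int (p $ a)) * int (p $ a))"
      using insert.hyps by (auto simp: vec_eq_iff axis_def)
    also have "u \<dots> = u (?v (insert a D))" by (rule Lam_multiple[OF assms])
    finally have "u (?v (insert a D)) = u (?v D)" ..
    with insert.IH show ?case by simp
  qed
  from this[of UNIV] show ?thesis by (simp add: reduce_def)
qed

text \<open>Translation permutes the period cell, up to reduction modulo \<open>p\<close>. This is what integration over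
  a torus gives in the continuous setting, and it justifies the summation by parts below.\<close>

lemma sum_T0_shift:
  fixes p :: "nat ^ 'n"
  assumes p: "\<And>j. p $ j \<ge> 1" and a: "a \<in> Lam p"
  shows "(\<Sum>i\<in>T0 p. a (i + k)) = (\<Sum>i\<in>T0 p. a i)"
proof -
  have pos: "int (p $ j) > 0" for j using p[of j] by simp
  have "(\<Sum>i\<in>T0 p. a (reduce p (i + k))) = (\<Sum>i\<in>T0 p. a i)"
  proof (rule sum.reindex_bij_witness[where i = "\<lambda>i. reduce p (i - k)" and j = "\<lambda>i. reduce p (i + k)"])
    fix i assume i: "i \<in> T0 p"
    then have i_mod: "i $ j mod int (p $ j) = i $ j" for j
      by (simp add: T0_def)
    show "reduce p (reduce p (i + k) - k) = i" "reduce p (reduce p (i - k) + k) = i"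
      using i_mod by (simp_all add: reduce_def vec_eq_iff mod_diff_left_eq mod_add_left_eq)
    show "reduce p (i - k) \<in> T0 p" "reduce p (i + k) \<in> T0 p"
      using pos by (simp_all add: reduce_def T0_def)
  qed simp
  then show ?thesis using Lam_reduce[OF a] by simp
qed

section \<open>The Euler-Lagrange operator\<close>

definition window :: "nat \<Rightarrow> int ^ 'n \<Rightarrow> (int ^ 'n \<Rightarrow> real) \<Rightarrow> int ^ 'n \<Rightarrow> real" where
  "window r j u = (\<lambda>k\<in>B r. u (j + k))"

lemma window_extensional: "window r j u \<in> extensional (B r)"
  by (simp add: window_def)

lemma S_window: "S r s j u = s (window r j u)"
  by (simp add: S_def window_def)

text \<open>The left-hand side of \<open>(E)\<close> at the site \<open>i\<close>: the site is seen by the potential centred at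
  \<open>i - k\<close> as its coordinate \<open>k\<close>.\<close>

definition gradient :: "nat \<Rightarrow> ((int ^ 'n \<Rightarrow> real) \<Rightarrow> real) \<Rightarrow> int ^ 'n \<Rightarrow> (int ^ 'n \<Rightarrow> real) \<Rightarrow> real" where
  "gradient r s i u = (\<Sum>k\<in>B r. partial k s (window r (i - k) u))"

lemma B_minus: "k \<in> B r \<Longrightarrow> - k \<in> B r"
  by (simp add: B_def znorm_minus)

lemma solution_iff_gradient: "solution r s u \<longleftrightarrow> (\<forall>i. gradient r s i u = 0)"
proof -
  have "(\<Sum>j | znorm (j - i) \<le> int r. partial i (S r s j) u) = gradient r s i u" for i
    unfolding gradient_def
  proof (rule sum.reindex_bij_witness[where i = "\<lambda>k. i - k" and j = "\<lambda>j. i - j"])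
    fix j assume "j \<in> {j. znorm (j - i) \<le> int r}"
    then have "- (i - j) \<in> B r" by (simp add: B_def)
    then show ij: "i - j \<in> B r" using B_minus by fastforce
    have "window r j (u(i := t)) = (window r j u)(i - j := t)" for t
      using ij by (auto simp: window_def fun_eq_iff restrict_def algebra_simps)
    moreover have "window r j u (i - j) = u i" using ij by (simp add: window_def)
    ultimately show "partial (i - j) s (window r (i - (i - j)) u) = partial i (S r s j) u"
      by (simp add: partial_def S_window)
  next
    fix k :: "int ^ 'a" assume "k \<in> B r"
    then have "- k \<in> B r" by (rule B_minus)
    then show "i - k \<in> {j. znorm (j - i) \<le> int r}" by (simp add: B_def)
  qed simp_all
  then show ?thesis by (simp add: solution_def)
qed

text \<open>The bound \<open>C\<close> of (S4) is a parameter, so that a step size can be written down explicitly.\<close>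

locale interaction =
  fixes r :: nat and s :: "(int ^ 'n \<Rightarrow> real) \<Rightarrow> real" and C :: real
  assumes range_pos: "r \<ge> 1" and C2: "C2_on (B r) s" and S3: "cond_S3 r s"
    and C_pos: "C > 0"
    and C_bound: "\<And>y i k. y \<in> extensional (B r) \<Longrightarrow> i \<in> B r \<Longrightarrow> k \<in> B r \<Longrightarrow> \<bar>partial2 i k s y\<bar> \<le> C"
begin

lemma znorm1_in_B: "znorm k = 1 \<Longrightarrow> k \<in> B r"
  using range_pos by (simp add: B_def)

lemma has_partial:
  assumes "y \<in> extensional (B r)" "k \<in> B r"
  shows "((\<lambda>t. s (y(k := t))) has_real_derivative partial k s (y(k := t))) (at t)"
  using C1_on_has_derivative[OF _ assms] C2 by (simp add: C2_on_def)

lemma has_partial2: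
  assumes "y \<in> extensional (B r)" "l \<in> B r" "k \<in> B r"
  shows "((\<lambda>t. partial k s (y(l := t))) has_real_derivative partial2 l k s (y(l := t))) (at t)"
  using C1_on_has_derivative[OF _ assms(1,2)] C2 assms(3) by (simp add: C2_on_def)

lemma partial_lipschitz_coord:
  assumes "y \<in> extensional (B r)" "l \<in> B r" "k \<in> B r"
  shows "\<bar>partial k s (y(l := b)) - partial k s (y(l := a))\<bar> \<le> C * \<bar>b - a\<bar>"
  using field_differentiable_bound[of UNIV "\<lambda>t. partial k s (y(l := t))"
      "\<lambda>t. partial2 l k s (y(l := t))" C b a] has_partial2[OF assms]
    C_bound[OF fun_upd_extensional[OF assms(1,2)] assms(2,3)] by simp

lemma partial_antimono_coord:
  assumes "y \<in> extensional (B r)" "l \<in> B r" "k \<in> B r" "l \<noteq> k" "a \<le> b"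
  shows "partial k s (y(l := b)) \<le> partial k s (y(l := a))"
proof (rule DERIV_nonpos_imp_nonincreasing[OF \<open>a \<le> b\<close>])
  fix t
  have "partial2 l k s (y(l := t)) \<le> 0"
    using S3 assms fun_upd_extensional[OF assms(1,2)] by (simp add: cond_S3_def)
  with has_partial2[OF assms(1,2,3)]
  show "\<exists>D. DERIV (\<lambda>t. partial k s (y(l := t))) t :> D \<and> D \<le> 0" by blast
qed

lemma partial_lipschitz:
  assumes "y \<in> extensional (B r)" "z \<in> extensional (B r)" "k \<in> B r"
  shows "\<bar>partial k s z - partial k s y\<bar> \<le> C * (\<Sum>l\<in>B r. \<bar>z l - y l\<bar>)"
  using telescope_abs[OF finite_B assms(1,2), of "partial k s" "\<lambda>_. 0" "\<lambda>l. C * \<bar>z l - y l\<bar>"]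
    partial_lipschitz_coord assms(3) by (simp add: sum_distrib_left)

text \<open>The twist condition in integrated form: raising coordinates other than \<open>k\<close> can only lower
  \<open>partial k s\<close>, so only the change of the coordinate \<open>k\<close> itself counts from above.\<close>

lemma partial_upper:
  assumes "y \<in> extensional (B r)" "z \<in> extensional (B r)" "k \<in> B r"
    and le: "\<And>l. l \<in> B r \<Longrightarrow> y l \<le> z l"
  shows "partial k s z - partial k s y \<le> C * (z k - y k)"
proof -
  have "partial k s z - partial k s y \<le> (\<Sum>l\<in>B r. if l = k then C * (z k - y k) else 0)"
  proof (rule telescope_le[OF finite_B assms(1,2)])
    fix l :: "int ^ 'n" and w :: "int ^ 'n \<Rightarrow> real" assume l: "l \<in> B r" and w: "w \<in> extensional (B r)"
    show "partial k s (w(l := z l)) - partial k s (w(l := y l)) \<le> (if l = k then C * (z k - y k) else 0)"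
      using partial_lipschitz_coord[OF w l assms(3), of "z l" "y l"] le[OF l]
        partial_antimono_coord[OF w l assms(3) _ le[OF l]] by auto
  qed
  also have "\<dots> = C * (z k - y k)"
    using assms(3) by (simp add: finite_B)
  finally show ?thesis .
qed

text \<open>Condition (S3) gives strictness for the derivative of \<open>partial k s\<close> in the coordinate \<open>0\<close>. This
  coordinate is changed last, so the monotonicity of the other changes suffices.\<close>

lemma partial_strict:
  assumes "y \<in> extensional (B r)" "z \<in> extensional (B r)" "znorm k = 1"
    and le: "\<And>l. l \<in> B r \<Longrightarrow> y l \<le> z l" and "y k = z k" "y 0 < z 0"
  shows "partial k s z < partial k s y"
proof -
  have k: "k \<in> B r" "k \<noteq> 0" using assms(3) znorm1_in_B by (auto simp: znorm_def)
  have "partial k s (z(0 := z 0)) < partial k s (z(0 := y 0))"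
  proof (rule DERIV_neg_imp_decreasing[OF \<open>y 0 < z 0\<close>])
    fix t
    have "partial2 0 k s (z(0 := t)) < 0"
      using S3 assms(3) fun_upd_extensional[OF assms(2) zero_in_B] by (simp add: cond_S3_def)
    with has_partial2[OF assms(2) zero_in_B k(1)]
    show "\<exists>D. DERIV (\<lambda>t. partial k s (z(0 := t))) t :> D \<and> D < 0" by blast
  qed
  moreover have "partial k s (z(0 := y 0)) - partial k s y \<le> C * ((z(0 := y 0)) k - y k)"
    using le k by (intro partial_upper assms fun_upd_extensional zero_in_B) auto
  ultimately show ?thesis using k assms(5) by simp
qed

text \<open>With Lipschitz partial derivatives, differentiability comes with a quadratic remainder; the
  linear term \<open>a\<close> of the telescoping lemma collects the differential.\<close>

lemma s_taylor:
  assumes "y \<in> extensional (B r)" "z \<in> extensional (B r)"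
  shows "\<bar>s z - s y - (\<Sum>k\<in>B r. partial k s y * (z k - y k))\<bar> \<le> C * (\<Sum>k\<in>B r. \<bar>z k - y k\<bar>)\<^sup>2"
proof -
  define D where "D = (\<Sum>k\<in>B r. \<bar>z k - y k\<bar>)"
  have "\<bar>s z - s y - (\<Sum>k\<in>B r. partial k s y * (z k - y k))\<bar> \<le> (\<Sum>k\<in>B r. C * D * \<bar>z k - y k\<bar>)"
  proof (rule telescope_abs[OF finite_B assms])
    fix l :: "int ^ 'n" and w :: "int ^ 'n \<Rightarrow> real" assume l: "l \<in> B r" and w: "w \<in> extensional (B r)"
      and mix: "\<And>m. w m = y m \<or> w m = z m"
    let ?f = "\<lambda>t. s (w(l := t)) - partial l s y * t"
    let ?I = "closed_segment (y l) (z l)"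
    have "norm (?f (z l) - ?f (y l)) \<le> (C * D) * norm (z l - y l)"
    proof (rule field_differentiable_bound[of ?I])
      fix t assume t: "t \<in> ?I"
      show "(?f has_real_derivative partial l s (w(l := t)) - partial l s y) (at t within ?I)"
        by (rule has_field_derivative_at_within)
           (auto intro!: derivative_eq_intros has_partial[OF w l])
      have "\<bar>partial l s (w(l := t)) - partial l s y\<bar> \<le> C * (\<Sum>k\<in>B r. \<bar>(w(l := t)) k - y k\<bar>)"
        by (intro partial_lipschitz assms fun_upd_extensional w l)
      also have "\<dots> \<le> C * D"
        unfolding D_def
      proof (intro mult_left_mono sum_mono)
        fix k
        have "\<bar>t - y l\<bar> \<le> \<bar>z l - y l\<bar>"
          using t by (auto simp: closed_segment_eq_real_ivl split: if_splits)
        then show "\<bar>(w(l := t)) k - y k\<bar> \<le> \<bar>z k - y k\<bar>"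
          using mix[of k] by auto
      qed (use C_pos in simp)
      finally show "norm (partial l s (w(l := t)) - partial l s y) \<le> C * D" by simp
    qed auto
    then show "\<bar>s (w(l := z l)) - s (w(l := y l)) - partial l s y * (z l - y l)\<bar> \<le> C * D * \<bar>z l - y l\<bar>"
      by (simp add: algebra_simps)
  qed
  also have "\<dots> = C * D * D" unfolding D_def by (simp add: sum_distrib_left)
  finally show ?thesis by (simp add: D_def power2_eq_square mult.assoc)
qed

text \<open>On the set of sites where \<open>u > v\<close>, the maximum arises from \<open>v\<close>, and \<open>u\<close> from the minimum, by the
  same upward change from \<open>v\<close> to \<open>u\<close>. The two differ only in the remaining coordinates, which are
  larger for the maximum, and there each partial derivative involved is smaller.\<close>

lemma s_submodular:
  assumes u: "u \<in> extensional (B r)" and v: "v \<in> extensional (B r)"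
  shows "s (\<lambda>k\<in>B r. max (u k) (v k)) + s (\<lambda>k\<in>B r. min (u k) (v k)) \<le> s u + s v"
proof -
  define glue where "glue w x = (\<lambda>k\<in>B r. if u k > v k then w k else x k)"
    for w x :: "int ^ 'n \<Rightarrow> real"
  have glue_ext: "glue w x \<in> extensional (B r)" for w x by (simp add: glue_def)
  define m where "m = (\<lambda>k\<in>B r. min (u k) (v k))"
  define g where "g w = s (glue w v) - s (glue w m)" for w
  have "g u - g v \<le> (\<Sum>l\<in>(B r :: (int ^ 'n) set). 0)"
  proof (rule telescope_le[OF finite_B v u])
    fix l :: "int ^ 'n" and w :: "int ^ 'n \<Rightarrow> real" assume l: "l \<in> B r" and w: "w \<in> extensional (B r)"
    show "g (w(l := u l)) - g (w(l := v l)) \<le> 0"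
    proof (cases "u l > v l")
      case True
      have upd: "glue (w(l := t)) x = (glue w x)(l := t)" for t x
        using l True by (auto simp: glue_def fun_eq_iff)
      have "g (w(l := u l)) \<le> g (w(l := v l))"
      proof (rule DERIV_nonpos_imp_nonincreasing[where f = "\<lambda>t. g (w(l := t))"])
        show "v l \<le> u l" using True by simp
        fix t
        have "((\<lambda>t. g (w(l := t))) has_real_derivative
            partial l s ((glue w v)(l := t)) - partial l s ((glue w m)(l := t))) (at t)"
          unfolding g_def upd
          by (intro DERIV_diff has_partial glue_ext l)
        moreover have "partial l s ((glue w v)(l := t)) - partial l s ((glue w m)(l := t))
            \<le> C * (((glue w v)(l := t)) l - ((glue w m)(l := t)) l)"
          by (intro partial_upper fun_upd_extensional glue_ext l) (auto simp: glue_def m_def)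
        ultimately show "\<exists>D. DERIV (\<lambda>t. g (w(l := t))) t :> D \<and> D \<le> 0" by auto
      qed
      then show ?thesis by simp
    next
      case False
      have "glue (w(l := t)) x = glue w x" for t x
        using False by (auto simp: glue_def fun_eq_iff)
      then show ?thesis by (simp add: g_def)
    qed
  qed
  moreover have "glue u v = (\<lambda>k\<in>B r. max (u k) (v k))" "glue u m = u" "glue v v = v" "glue v m = m"
    using u v by (auto simp: glue_def m_def fun_eq_iff extensional_def)
  ultimately show ?thesis by (simp add: g_def m_def)
qed

section \<open>Comparison of configurations\<close>

definition nB :: real where "nB = real (card (B r :: (int ^ 'n) set))"

lemma nB_ge_1: "nB \<ge> 1"
proof -
  have "card (B r :: (int ^ 'n) set) > 0" using zero_in_B finite_B by (auto simp: card_gt_0_iff)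
  then show ?thesis by (simp add: nB_def)
qed

lemma gradient_lipschitz:
  "\<bar>gradient r s i v - gradient r s i u\<bar>
    \<le> C * (\<Sum>k\<in>B r. \<Sum>l\<in>B r. \<bar>v (i - k + l) - u (i - k + l)\<bar>)"
proof -
  have "\<bar>gradient r s i v - gradient r s i u\<bar>
      \<le> (\<Sum>k\<in>B r. \<bar>partial k s (window r (i - k) v) - partial k s (window r (i - k) u)\<bar>)"
    unfolding gradient_def sum_subtractf[symmetric] by (rule sum_abs)
  also have "\<dots> \<le> (\<Sum>k\<in>B r. C * (\<Sum>l\<in>B r. \<bar>window r (i - k) v l - window r (i - k) u l\<bar>))"
    by (intro sum_mono partial_lipschitz window_extensional)
  also have "\<dots> = C * (\<Sum>k\<in>B r. \<Sum>l\<in>B r. \<bar>v (i - k + l) - u (i - k + l)\<bar>)"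
    by (simp add: window_def sum_distrib_left)
  finally show ?thesis .
qed

lemma gradient_upper:
  assumes "\<And>j. u j \<le> v j"
  shows "gradient r s i v - gradient r s i u \<le> nB * C * (v i - u i)"
proof -
  have "gradient r s i v - gradient r s i u
      = (\<Sum>k\<in>B r. partial k s (window r (i - k) v) - partial k s (window r (i - k) u))"
    by (simp add: gradient_def sum_subtractf)
  also have "\<dots> \<le> (\<Sum>k\<in>B r. C * (window r (i - k) v k - window r (i - k) u k))"
    by (intro sum_mono partial_upper window_extensional) (auto simp: window_def assms)
  also have "\<dots> = nB * C * (v i - u i)"
    by (simp add: window_def nB_def)
  finally show ?thesis .
qed

text \<open>The potential centred at the neighbour \<open>i - k\<close> is responsible for the strict inequality.\<close>

lemma gradient_strict:
  assumes le: "\<And>j. u j \<le> v j" and "u i = v i" "znorm k = 1" "u (i - k) < v (i - k)"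
  shows "gradient r s i v < gradient r s i u"
proof -
  have "partial l s (window r (i - l) v) - partial l s (window r (i - l) u)
     \<le> C * (window r (i - l) v l - window r (i - l) u l)" if "l \<in> B r" for l
    using that le by (intro partial_upper window_extensional) (auto simp: window_def)
  then have "partial l s (window r (i - l) v) \<le> partial l s (window r (i - l) u)"
    if "l \<in> B r" for l
    using that \<open>u i = v i\<close> by (fastforce simp: window_def)
  moreover have "partial k s (window r (i - k) v) < partial k s (window r (i - k) u)"
    using assms znorm1_in_B
    by (intro partial_strict window_extensional) (auto simp: window_def zero_in_B)
  ultimately show ?thesis
    unfolding gradient_def using finite_B znorm1_in_B[OF assms(3)]
    by (intro sum_strict_mono_ex1) auto
qed

text \<open>A discrete strong maximum principle: if \<open>u\<close> and \<open>v\<close> agree at a site but not at one of its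
  neighbours, then \<open>gradient_strict\<close> contradicts that both gradients vanish there.\<close>

lemma strong_comparison:
  assumes le: "\<And>j. u j \<le> v j" and "\<And>j. gradient r s j u = 0" "\<And>j. gradient r s j v = 0"
    and "u i = v i"
  shows "u = v"
proof
  fix j show "u j = v j"
  proof (rule lattice_connected[where P = "\<lambda>j. u j = v j", OF \<open>u i = v i\<close>])
    fix i k :: "int ^ 'n" assume i: "u i = v i" and k: "znorm k = 1"
    show "u (i - k) = v (i - k)"
      using gradient_strict[of u v i k, OF le i k] le[of "i - k"] assms(2,3) by fastforce
  qed
qed

lemma continuous_on_window:
  "continuous_on A (\<lambda>u. window r i u)"
proof (rule continuous_on_coordinatewise_then_product)
  fix k
  show "continuous_on A (\<lambda>u. window r i u k)"
    by (cases "k \<in> B r")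
       (auto simp: window_def intro: continuous_on_subset[OF continuous_on_product_coordinates])
qed

lemma continuous_on_S: "continuous_on A (S r s i)"
proof -
  have "continuous_on (extensional (B r)) s" using C2 by (simp add: C2_on_def C1_on_def)
  then have "continuous_on A (\<lambda>u. s (window r i u))"
    by (rule continuous_on_compose2[OF _ continuous_on_window]) (auto simp: window_extensional)
  then show ?thesis by (simp add: S_window[abs_def])
qed

lemma continuous_on_gradient: "continuous_on A (gradient r s i)"
  unfolding gradient_def[abs_def]
proof (rule continuous_on_sum)
  fix k :: "int ^ 'n" assume "k \<in> B r"
  then have "continuous_on (extensional (B r)) (partial k s)"
    using C2 by (simp add: C2_on_def C1_on_def)
  then show "continuous_on A (\<lambda>u. partial k s (window r (i - k) u))"
    by (rule continuous_on_compose2[OF _ continuous_on_window]) (auto simp: window_extensional)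
qed

lemma S_has_derivative:
  "((\<lambda>t. S r s j (\<lambda>i. u i + t * x i)) has_real_derivative
     (\<Sum>k\<in>B r. partial k s (window r j (\<lambda>i. u i + t * x i)) * x (j + k))) (at t)"
proof (rule has_real_derivative_quadratic_remainder)
  fix h
  let ?W = "\<lambda>t. window r j (\<lambda>i. u i + t * x i)"
  have diff: "?W (t + h) k - ?W t k = h * x (j + k)" if "k \<in> B r" for k
    using that by (simp add: window_def algebra_simps)
  have "(\<Sum>k\<in>B r. partial k s (?W t) * (?W (t + h) k - ?W t k))
      = h * (\<Sum>k\<in>B r. partial k s (?W t) * x (j + k))"
    unfolding sum_distrib_left by (intro sum.cong) (simp_all only: diff mult.left_commute)
  moreover have "(\<Sum>k\<in>B r. \<bar>?W (t + h) k - ?W t k\<bar>) = \<bar>h\<bar> * (\<Sum>k\<in>B r. \<bar>x (j + k)\<bar>)"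
    by (simp add: diff sum_distrib_left abs_mult)
  ultimately show "\<bar>S r s j (\<lambda>i. u i + (t + h) * x i) - S r s j (\<lambda>i. u i + t * x i)
      - h * (\<Sum>k\<in>B r. partial k s (?W t) * x (j + k))\<bar> \<le> (C * (\<Sum>k\<in>B r. \<bar>x (j + k)\<bar>)\<^sup>2) * h\<^sup>2"
    using s_taylor[of "?W t" "?W (t + h)", OF window_extensional window_extensional]
    by (simp only: S_window power_mult_distrib power2_abs mult_ac)
qed

end

section \<open>The energy of periodic configurations\<close>

lemma Lam_iff_translate: "u \<in> Lam p \<longleftrightarrow> (\<forall>j. (\<lambda>i. u (i + axis j (int (p $ j)))) = u)"
  by (auto simp: Lam_def fun_eq_iff)

lemma LamD: "u \<in> Lam p \<Longrightarrow> u (i + axis j (int (p $ j))) = u i"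
  by (simp add: Lam_def)

lemma Lam_translate:
  assumes "u \<in> Lam p" shows "(\<lambda>i. u (i + k)) \<in> Lam p"
proof -
  have "u (i + axis j (int (p $ j)) + k) = u (i + k)" for i j
  proof -
    have "i + axis j (int (p $ j)) + k = i + k + axis j (int (p $ j))" by (simp add: add_ac)
    then show ?thesis by (simp only: LamD[OF assms])
  qed
  then show ?thesis by (simp add: Lam_def)
qed

lemma window_translate: "window r (j + k) u = window r j (\<lambda>i. u (i + k))"
  by (simp add: window_def fun_eq_iff restrict_def algebra_simps)

lemma S_translate: "S r s (j + k) u = S r s j (\<lambda>i. u (i + k))"
  by (simp add: S_window window_translate)

lemma gradient_translate: "gradient r s (i + k) u = gradient r s i (\<lambda>j. u (j + k))"
proof -
  have "i + k - l = i - l + k" for l by (simp add: algebra_simps)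
  then show ?thesis by (simp only: gradient_def window_translate)
qed

lemma window_Lam:
  assumes "u \<in> Lam p" shows "window r (i + axis j (int (p $ j))) u = window r i u"
  using assms unfolding window_translate Lam_iff_translate by simp

lemma S_Lam: "u \<in> Lam p \<Longrightarrow> (\<lambda>i. S r s i u) \<in> Lam p"
  unfolding Lam_iff_translate S_translate by simp

lemma gradient_Lam: "u \<in> Lam p \<Longrightarrow> (\<lambda>i. gradient r s i u) \<in> Lam p"
  unfolding Lam_iff_translate gradient_translate by simp

lemma closed_Lam: "closed (Lam p)" for p :: "nat ^ 'n"
proof -
  have "Lam p = (\<Inter>i. \<Inter>j. {u. u (i + axis j (int (p $ j))) = u i})"
    by (auto simp: Lam_def)
  then show ?thesis
    by (simp only:) (intro closed_INT ballI closed_Collect_eq continuous_on_product_coordinates)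
qed

locale periodic_interaction = interaction r s C
  for r and s :: "(int ^ 'n \<Rightarrow> real) \<Rightarrow> real" and C +
  fixes p :: "nat ^ 'n"
  assumes p: "\<And>j. p $ j \<ge> 1"
begin

abbreviation J where "J \<equiv> J0 r s p"
abbreviation E where "E \<equiv> gradient r s"

lemma zero_in_T0: "0 \<in> T0 p"
  using p by (auto simp: T0_def Suc_le_eq)

lemma reduce_in_T0: "reduce p i \<in> T0 p"
proof -
  have "int (p $ j) > 0" for j using p[of j] by simp
  then show ?thesis by (simp add: reduce_def T0_def)
qed

lemma Lam_eqI:
  assumes "u \<in> Lam p" "v \<in> Lam p" "\<And>i. i \<in> T0 p \<Longrightarrow> u i = v i"
  shows "u = v"
proof
  fix i
  have "u (reduce p i) = v (reduce p i)" by (rule assms(3)[OF reduce_in_T0])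
  then show "u i = v i" by (simp only: Lam_reduce[OF assms(1)] Lam_reduce[OF assms(2)])
qed

lemma J_translate: "u \<in> Lam p \<Longrightarrow> J (\<lambda>i. u (i + k)) = J u"
  unfolding J0_def S_translate[symmetric] by (rule sum_T0_shift[OF p S_Lam])

text \<open>Summation by parts over the period cell collects, for each site, the contributions of all
  potentials that see it.\<close>

lemma J_has_derivative:
  assumes u: "u \<in> Lam p" and x: "x \<in> Lam p"
  shows "((\<lambda>t. J (\<lambda>i. u i + t * x i)) has_real_derivative
    (\<Sum>i\<in>T0 p. x i * E i (\<lambda>i. u i + t * x i))) (at t)"
proof -
  let ?v = "\<lambda>i. u i + t * x i"
  have v: "?v \<in> Lam p" using u x by (simp add: Lam_def)
  let ?a = "\<lambda>k j. partial k s (window r j ?v) * x (j + k)"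
  have "?a k \<in> Lam p" for k
    using window_Lam[OF v] Lam_translate[OF x, of k] by (simp add: Lam_def)
  then have "(\<Sum>j\<in>T0 p. ?a k (j + (- k))) = (\<Sum>j\<in>T0 p. ?a k j)" for k
    by (rule sum_T0_shift[OF p])
  then have shift: "(\<Sum>j\<in>T0 p. ?a k j) = (\<Sum>j\<in>T0 p. partial k s (window r (j - k) ?v) * x j)" for k
    by (simp only: add_uminus_conv_diff diff_add_cancel)
  have "(\<Sum>j\<in>T0 p. \<Sum>k\<in>B r. ?a k j) = (\<Sum>k\<in>B r. \<Sum>j\<in>T0 p. partial k s (window r (j - k) ?v) * x j)"
    by (subst sum.swap) (simp only: shift)
  also have "\<dots> = (\<Sum>i\<in>T0 p. x i * E i ?v)"
    by (subst sum.swap) (simp add: gradient_def sum_distrib_left mult.commute)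
  finally show ?thesis
    unfolding J0_def by (auto intro!: derivative_eq_intros S_has_derivative)
qed

lemma Lam_norm_ge:
  assumes "x \<in> Lam p" shows "\<bar>x i\<bar> \<le> Lam_norm p x"
proof -
  have "(x (reduce p i))\<^sup>2 \<le> (\<Sum>j\<in>T0 p. (x j)\<^sup>2)"
    by (rule member_le_sum[OF reduce_in_T0]) (auto simp: finite_T0)
  then have "sqrt ((x i)\<^sup>2) \<le> sqrt (\<Sum>j\<in>T0 p. (x j)\<^sup>2)"
    unfolding Lam_reduce[OF assms] by (rule real_sqrt_le_mono)
  then show ?thesis by (simp add: Lam_norm_def L2_set_def)
qed

text \<open>As the gradient is Lipschitz and vanishes at \<open>u + v0\<close>, the energy varies there by at most a
  constant times the squared norm, which is stronger than having zero as Frechet derivative.\<close>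

lemma critical_pointI:
  assumes u: "u \<in> Lam p" and v0: "v0 \<in> Lam p" and zero: "\<And>i. E i (\<lambda>i. u i + v0 i) = 0"
  shows "critical_point p (I0 r s v0 p) u"
proof -
  define U where "U = (\<lambda>i. u i + v0 i)"
  have U: "U \<in> Lam p" using u v0 by (simp add: U_def Lam_def)
  define K where "K = real (card (T0 p)) * (C * nB\<^sup>2)"
  have K: "K \<ge> 0" using C_pos by (simp add: K_def)
  have quadratic: "\<bar>J (\<lambda>i. U i + x i) - J U\<bar> \<le> K * (Lam_norm p x)\<^sup>2" if x: "x \<in> Lam p" for x
  proof -
    let ?N = "Lam_norm p x"
    have "\<exists>t. 0 < t \<and> t < 1 \<and> J (\<lambda>i. U i + 1 * x i) - J (\<lambda>i. U i + 0 * x i)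
        = (1 - 0) * (\<Sum>i\<in>T0 p. x i * E i (\<lambda>i. U i + t * x i))"
      by (rule MVT2) (simp_all only: zero_less_one J_has_derivative[OF U x])
    then obtain t where t: "0 < t" "t < 1" and
      eq: "J (\<lambda>i. U i + x i) - J U = (\<Sum>i\<in>T0 p. x i * E i (\<lambda>i. U i + t * x i))"
      by auto
    have "\<bar>x i * E i (\<lambda>i. U i + t * x i)\<bar> \<le> ?N * (C * nB\<^sup>2 * ?N)" for i
    proof -
      have tx: "\<bar>t * x j\<bar> \<le> ?N" for j
        using t Lam_norm_ge[OF x, of j] mult_mono[of t 1 "\<bar>x j\<bar>" ?N] by (simp add: abs_mult)
      have "\<bar>E i (\<lambda>i. U i + t * x i)\<bar> = \<bar>E i (\<lambda>i. U i + t * x i) - E i U\<bar>"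
        using zero by (simp add: U_def)
      also have "\<dots> \<le> C * (\<Sum>k\<in>B r. \<Sum>l\<in>B r. \<bar>t * x (i - k + l)\<bar>)"
        using gradient_lipschitz[of i "\<lambda>i. U i + t * x i" U] by simp
      also have "\<dots> \<le> C * (\<Sum>k\<in>(B r :: (int ^ 'n) set). \<Sum>l\<in>(B r :: (int ^ 'n) set). ?N)"
        using C_pos by (intro mult_left_mono sum_mono tx) simp
      also have "\<dots> = C * nB\<^sup>2 * ?N" by (simp add: nB_def power2_eq_square)
      finally show ?thesis
        unfolding abs_mult using Lam_norm_ge[OF x, of i] by (intro mult_mono) auto
    qed
    then have "\<bar>\<Sum>i\<in>T0 p. x i * E i (\<lambda>i. U i + t * x i)\<bar> \<le> (\<Sum>i\<in>T0 p. ?N * (C * nB\<^sup>2 * ?N))"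
      by (intro order_trans[OF sum_abs] sum_mono)
    also have "\<dots> = K * ?N\<^sup>2" by (simp add: K_def power2_eq_square)
    finally show ?thesis using eq by simp
  qed
  have "\<exists>d>0. \<forall>x\<in>Lam p. Lam_norm p x < d \<longrightarrow>
      \<bar>I0 r s v0 p (\<lambda>i. u i + x i) - I0 r s v0 p u\<bar> \<le> e * Lam_norm p x" if e: "e > 0" for e
  proof (intro exI conjI ballI impI)
    show "e / (K + 1) > 0" using e K by simp
    fix x assume x: "x \<in> Lam p" and small: "Lam_norm p x < e / (K + 1)"
    have "K * Lam_norm p x \<le> e"
    proof -
      have "Lam_norm p x * (K + 1) < e" using small K by (simp add: pos_less_divide_eq)
      moreover have "Lam_norm p x \<ge> 0" using Lam_norm_ge[OF x, of 0] by simp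
      ultimately show ?thesis by (simp add: algebra_simps)
    qed
    then have "K * (Lam_norm p x)\<^sup>2 \<le> e * Lam_norm p x"
      using mult_right_mono[of "K * Lam_norm p x" e "Lam_norm p x"] Lam_norm_ge[OF x, of 0]
      by (simp add: power2_eq_square mult.assoc)
    moreover have "I0 r s v0 p (\<lambda>i. u i + x i) = J (\<lambda>i. U i + x i)" "I0 r s v0 p u = J U"
      by (simp_all add: I0_def U_def algebra_simps)
    ultimately show "\<bar>I0 r s v0 p (\<lambda>i. u i + x i) - I0 r s v0 p u\<bar> \<le> e * Lam_norm p x"
      using quadratic[OF x] by simp
  qed
  then show ?thesis
    using u by (auto simp: critical_point_def has_frechet_derivative_def intro!: exI[of _ 0])
qed

text \<open>The step size is half of the inverse of \<open>C * nB\<^sup>2\<close>, which bounds the Lipschitz constant of the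
  gradient; \<open>descend_mono\<close> and \<open>descend_decreases\<close> both depend on this choice.\<close>

definition grad_sq where "grad_sq u = (\<Sum>i\<in>T0 p. (E i u)\<^sup>2)"
definition step_size :: real where "step_size = 1 / (2 * C * nB\<^sup>2)"
definition descend where "descend u = (\<lambda>i. u i - step_size * E i u)"

lemma step_size_pos: "step_size > 0"
  using C_pos nB_ge_1 by (simp add: step_size_def)

lemma step_size_eq: "C * nB\<^sup>2 * step_size = 1 / 2"
  using C_pos nB_ge_1 by (simp add: step_size_def)

lemma grad_sq_nonneg: "grad_sq u \<ge> 0"
  by (simp add: grad_sq_def sum_nonneg)

lemma gradient_eq_0:
  assumes "u \<in> Lam p" "grad_sq u = 0" shows "E i u = 0"
proof -
  have "E (reduce p i) u = 0"
    using assms(2) reduce_in_T0 by (simp add: grad_sq_def sum_nonneg_eq_0_iff finite_T0)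
  then show ?thesis using Lam_reduce[OF gradient_Lam[OF assms(1)]] by simp
qed

lemma descend_Lam: "u \<in> Lam p \<Longrightarrow> descend u \<in> Lam p"
  using gradient_Lam[of u p r s] by (simp add: descend_def Lam_def)

text \<open>By \<open>gradient_upper\<close> the descent at \<open>i\<close> can undo at most a fraction of the gap \<open>v i - u i\<close>.\<close>

lemma descend_mono:
  assumes le: "\<And>j. u j \<le> v j" shows "descend u i \<le> descend v i"
proof -
  have "step_size * (E i v - E i u) \<le> step_size * (nB * C * (v i - u i))"
    using gradient_upper[OF le] step_size_pos by (intro mult_left_mono) auto
  also have "\<dots> = (C * nB * step_size) * (v i - u i)" by simp
  also have "\<dots> \<le> 1 * (v i - u i)"
  proof (rule mult_right_mono)
    have "C * step_size * nB \<le> C * step_size * nB\<^sup>2"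
      using nB_ge_1 C_pos step_size_pos by (intro mult_left_mono) (auto simp: power2_eq_square)
    then show "C * nB * step_size \<le> 1" using step_size_eq by (simp add: mult_ac)
  qed (use le in simp)
  finally show ?thesis by (simp add: descend_def algebra_simps)
qed

text \<open>Along the segment from \<open>u\<close> to \<open>descend u\<close> the gradient stays close enough to its initial value
  for the energy to decrease at no less than half of the initial rate.\<close>

lemma descend_decreases:
  assumes u: "u \<in> Lam p"
  shows "J (descend u) \<le> J u - step_size / 2 * grad_sq u"
proof -
  let ?x = "\<lambda>i. - E i u"
  have x: "?x \<in> Lam p" using gradient_Lam[OF u, of r s] by (simp add: Lam_def)
  have "\<exists>t. 0 < t \<and> t < step_size \<and> J (\<lambda>i. u i + step_size * ?x i) - J (\<lambda>i. u i + 0 * ?x i)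
        = (step_size - 0) * (\<Sum>i\<in>T0 p. ?x i * E i (\<lambda>i. u i + t * ?x i))"
    by (rule MVT2) (simp_all only: step_size_pos J_has_derivative[OF u x])
  then obtain t where t: "0 < t" "t < step_size" and
    eq: "J (descend u) - J u = step_size * (\<Sum>i\<in>T0 p. ?x i * E i (\<lambda>i. u i + t * ?x i))"
    by (auto simp: descend_def)
  let ?e = "\<lambda>i k l. (E i u)\<^sup>2 / 2 + (E (i - k + l) u)\<^sup>2 / 2"
  \<comment> \<open>By the inequality of arithmetic and geometric means for products of gradients at two sites.\<close>
  have pointwise: "?x i * E i (\<lambda>i. u i + t * ?x i) \<le> - (E i u)\<^sup>2 + C * t * (\<Sum>k\<in>B r. \<Sum>l\<in>B r. ?e i k l)" for i
  proof -
    have split: "?x i * E i (\<lambda>i. u i + t * ?x i)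
        = - (E i u)\<^sup>2 + ?x i * (E i (\<lambda>i. u i + t * ?x i) - E i u)"
      by (simp add: power2_eq_square algebra_simps)
    have "?x i * (E i (\<lambda>i. u i + t * ?x i) - E i u)
        \<le> \<bar>?x i\<bar> * \<bar>E i (\<lambda>i. u i + t * ?x i) - E i u\<bar>"
      unfolding abs_mult[symmetric] by (rule abs_ge_self)
    also have "\<dots> \<le> \<bar>?x i\<bar> * (C * (\<Sum>k\<in>B r. \<Sum>l\<in>B r. \<bar>t * ?x (i - k + l)\<bar>))"
      using gradient_lipschitz[of i "\<lambda>i. u i + t * ?x i" u]
      by (intro mult_left_mono abs_ge_zero) (simp only: add_diff_cancel_left')
    also have "\<dots> = C * t * (\<Sum>k\<in>B r. \<Sum>l\<in>B r. \<bar>E i u\<bar> * \<bar>E (i - k + l) u\<bar>)"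
      using t by (simp only: abs_mult abs_minus abs_of_pos sum_distrib_left mult_ac)
    also have "\<dots> \<le> C * t * (\<Sum>k\<in>B r. \<Sum>l\<in>B r. ?e i k l)"
    proof (intro mult_left_mono sum_mono)
      fix k l
      show "\<bar>E i u\<bar> * \<bar>E (i - k + l) u\<bar> \<le> ?e i k l"
        using sum_squares_bound[of "\<bar>E i u\<bar>" "\<bar>E (i - k + l) u\<bar>"] by simp
    qed (use t C_pos in simp)
    finally show ?thesis unfolding split by (rule add_left_mono)
  qed
  have total: "(\<Sum>i\<in>T0 p. \<Sum>k\<in>B r. \<Sum>l\<in>B r. ?e i k l) = nB\<^sup>2 * grad_sq u"
  proof -
    have "(\<lambda>i. (E i u)\<^sup>2) \<in> Lam p" using gradient_Lam[OF u, of r s] by (simp add: Lam_def)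
    note shift_Lam = sum_T0_shift[OF p this]
    have shift: "(\<Sum>i\<in>T0 p. (E (i - k + l) u)\<^sup>2) = grad_sq u" for k l
    proof -
      have "i - k + l = i + (l - k)" for i by (simp add: algebra_simps)
      then show ?thesis by (simp only: grad_sq_def shift_Lam)
    qed
    have "(\<Sum>i\<in>T0 p. \<Sum>k\<in>B r. \<Sum>l\<in>B r. ?e i k l) = (\<Sum>k\<in>B r. \<Sum>i\<in>T0 p. \<Sum>l\<in>B r. ?e i k l)"
      by (rule sum.swap)
    also have "\<dots> = (\<Sum>k\<in>B r. \<Sum>l\<in>B r. \<Sum>i\<in>T0 p. ?e i k l)"
      by (intro sum.cong sum.swap refl)
    also have "\<dots> = (\<Sum>k\<in>(B r :: (int ^ 'n) set). \<Sum>l\<in>(B r :: (int ^ 'n) set). grad_sq u)"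
      by (simp only: sum.distrib sum_divide_distrib[symmetric] shift) (simp add: grad_sq_def)
    finally show ?thesis by (simp add: nB_def power2_eq_square)
  qed
  have "(\<Sum>i\<in>T0 p. ?x i * E i (\<lambda>i. u i + t * ?x i))
      \<le> (\<Sum>i\<in>T0 p. - (E i u)\<^sup>2 + C * t * (\<Sum>k\<in>B r. \<Sum>l\<in>B r. ?e i k l))"
    by (rule sum_mono[OF pointwise])
  also have "\<dots> = - grad_sq u + C * t * (nB\<^sup>2 * grad_sq u)"
    by (subst sum.distrib) (simp only: sum_negf sum_distrib_left[symmetric] total grad_sq_def)
  also have "\<dots> \<le> - grad_sq u + C * step_size * (nB\<^sup>2 * grad_sq u)"
    using t C_pos grad_sq_nonneg by (intro add_left_mono mult_right_mono mult_left_mono) auto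
  also have "\<dots> = - (1 - C * nB\<^sup>2 * step_size) * grad_sq u" by (simp add: algebra_simps)
  also have "\<dots> = - grad_sq u / 2" by (simp add: step_size_eq)
  finally have "J (descend u) - J u \<le> step_size * (- grad_sq u / 2)"
    unfolding eq using step_size_pos by (intro mult_left_mono) auto
  then show ?thesis by (simp add: algebra_simps)
qed

lemma J_submodular:
  "J (\<lambda>i. max (u i) (v i)) + J (\<lambda>i. min (u i) (v i)) \<le> J u + J v"
proof -
  have "S r s j (\<lambda>i. max (u i) (v i)) + S r s j (\<lambda>i. min (u i) (v i)) \<le> S r s j u + S r s j v" for j
  proof -
    have "window r j (\<lambda>i. max (u i) (v i)) = (\<lambda>k\<in>B r. max (window r j u k) (window r j v k))"
      "window r j (\<lambda>i. min (u i) (v i)) = (\<lambda>k\<in>B r. min (window r j u k) (window r j v k))"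
      by (auto simp: window_def fun_eq_iff)
    then show ?thesis
      using s_submodular[OF window_extensional window_extensional, of j u j v]
      by (simp add: S_window)
  qed
  then show ?thesis
    unfolding J0_def sum.distrib[symmetric] by (rule sum_mono)
qed

lemma continuous_on_J: "continuous_on A J"
  unfolding J0_def[abs_def] by (intro continuous_on_sum continuous_on_S)

lemma continuous_on_grad_sq: "continuous_on A grad_sq"
  unfolding grad_sq_def[abs_def] by (intro continuous_intros continuous_on_gradient)

lemma continuous_on_descend: "continuous_on A descend"
  unfolding descend_def[abs_def]
  by (intro continuous_intros continuous_on_gradient continuous_on_coordinatewise_then_product
      continuous_on_subset[OF continuous_on_product_coordinates]) auto

end

section \<open>A minimax principle\<close>

text \<open>The function \<open>\<bar>f - d\<bar> + Q\<close> attains its minimum on the compact set, and the minimum is zero: the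
  image under \<open>D\<close> of a path that stays below \<open>d + \<epsilon>\<close> is again a path, hence reaches nearly the
  level \<open>d\<close>, so that at some point of the original path \<open>f\<close> is close to \<open>d\<close> and the decrease \<open>Q\<close>
  is small.\<close>

lemma minimax_critical_point:
  fixes K :: "'a :: topological_space set" and f Q :: "'a \<Rightarrow> real"
    and D :: "'a \<Rightarrow> 'a" and x y :: 'a
  defines "paths \<equiv> {h :: real \<Rightarrow> 'a. continuous_on {0..1} h \<and> h ` {0..1} \<subseteq> K \<and> h 0 = x \<and> h 1 = y}"
  defines "d \<equiv> INF h\<in>paths. SUP \<theta>\<in>{0..1}. f (h \<theta>)"
  assumes K: "compact K" and cont: "continuous_on K f" "continuous_on K Q" "continuous_on K D"
    and Q: "\<And>u. u \<in> K \<Longrightarrow> Q u \<ge> 0" and D: "\<And>u. u \<in> K \<Longrightarrow> D u \<in> K"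
    and decr: "\<And>u. u \<in> K \<Longrightarrow> f (D u) \<le> f u - Q u"
    and ends: "D x = x" "D y = y" and paths: "paths \<noteq> {}"
  shows "\<exists>u\<in>K. f u = d \<and> Q u = 0"
proof -
  obtain h0 where h0: "h0 \<in> paths" using paths by blast
  have cont_h: "continuous_on {0..1} (\<lambda>\<theta>. f (h \<theta>))" if "h \<in> paths" for h
    using that by (intro continuous_on_compose2[OF cont(1)]) (simp_all add: paths_def)
  have bdd: "bdd_above ((\<lambda>\<theta>. f (h \<theta>)) ` {0..1})" if "h \<in> paths" for h
    by (intro bounded_imp_bdd_above compact_imp_bounded compact_continuous_image
        cont_h[OF that] compact_Icc)
  have "K \<noteq> {}" using h0 by (auto simp: paths_def)
  then obtain m where m: "m \<in> K" "\<And>u. u \<in> K \<Longrightarrow> f m \<le> f u"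
    using continuous_attains_inf[OF K _ cont(1)] by blast
  have bdd_d: "bdd_below ((\<lambda>h. SUP \<theta>\<in>{0..1}. f (h \<theta>)) ` paths)"
  proof (rule bdd_belowI2)
    fix h assume h: "h \<in> paths"
    then have "f m \<le> f (h 0)" by (intro m(2)) (auto simp: paths_def)
    also have "\<dots> \<le> (SUP \<theta>\<in>{0..1}. f (h \<theta>))" by (rule cSUP_upper[OF _ bdd[OF h]]) simp
    finally show "f m \<le> (SUP \<theta>\<in>{0..1}. f (h \<theta>))" .
  qed
  obtain u where u: "u \<in> K" and least: "\<And>v. v \<in> K \<Longrightarrow> \<bar>f u - d\<bar> + Q u \<le> \<bar>f v - d\<bar> + Q v"
  proof -
    have "continuous_on K (\<lambda>v. \<bar>f v - d\<bar> + Q v)" by (intro continuous_intros cont)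
    then show thesis using continuous_attains_inf[OF K \<open>K \<noteq> {}\<close>] that by blast
  qed
  have "\<bar>f u - d\<bar> + Q u \<le> 0"
  proof (rule ccontr)
    define \<epsilon> where "\<epsilon> = (\<bar>f u - d\<bar> + Q u) / 3"
    assume "\<not> ?thesis"
    then have \<epsilon>: "\<epsilon> > 0" by (simp add: \<epsilon>_def)
    have "\<exists>h\<in>paths. (SUP \<theta>\<in>{0..1}. f (h \<theta>)) < d + \<epsilon>"
      using cINF_less_iff[OF paths bdd_d, of "d + \<epsilon>"] \<epsilon> unfolding d_def by simp
    then obtain h where h: "h \<in> paths" and sup_h: "(SUP \<theta>\<in>{0..1}. f (h \<theta>)) < d + \<epsilon>" by blast
    have "continuous_on {0..1} (\<lambda>\<theta>. D (h \<theta>))"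
      using h by (intro continuous_on_compose2[OF cont(3)]) (simp_all add: paths_def)
    then have Dh: "(\<lambda>\<theta>. D (h \<theta>)) \<in> paths"
      using h D by (simp add: paths_def image_subset_iff ends)
    have "d \<le> (SUP \<theta>\<in>{0..1}. f (D (h \<theta>)))"
      unfolding d_def by (rule cINF_lower[OF bdd_d Dh])
    then have "d - \<epsilon> < (SUP \<theta>\<in>{0..1}. f (D (h \<theta>)))" using \<epsilon> by simp
    then obtain \<theta> where \<theta>: "\<theta> \<in> {0..1}" "d - \<epsilon> < f (D (h \<theta>))"
      using less_cSUP_iff[OF _ bdd[OF Dh]] by auto
    have v: "h \<theta> \<in> K" using h \<theta>(1) by (auto simp: paths_def)
    have "f (h \<theta>) \<le> (SUP \<theta>\<in>{0..1}. f (h \<theta>))" by (rule cSUP_upper[OF \<theta>(1) bdd[OF h]])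
    then have "f (h \<theta>) < d + \<epsilon>" using sup_h by simp
    with \<theta>(2) decr[OF v] Q[OF v] have "\<bar>f (h \<theta>) - d\<bar> + Q (h \<theta>) < 3 * \<epsilon>" by linarith
    with least[OF v] show False by (simp add: \<epsilon>_def)
  qed
  with Q[OF u] u show ?thesis by (intro bexI[of _ u]) auto
qed

section \<open>Minimizers between two adjacent constants\<close>

text \<open>Here \<open>a\<close> and \<open>b\<close> are the values of the constant functions \<open>v0\<close> and \<open>w0\<close>. The order interval
  is that of \<open>u + v0\<close> for \<open>u\<close> in \<open>G0\<close>, so the energy need not be shifted.\<close>

locale adjacent_minima = periodic_interaction r s C p
  for r and s :: "(int ^ 'n \<Rightarrow> real) \<Rightarrow> real" and C and p :: "nat ^ 'n" +
  fixes a b :: real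
  assumes ab: "a < b"
    and min_a: "\<And>c. S r s 0 (\<lambda>_. a) \<le> S r s 0 (\<lambda>_. c)"
    and min_b: "S r s 0 (\<lambda>_. b) = S r s 0 (\<lambda>_. a)"
    and gap: "\<And>c. a < c \<Longrightarrow> c < b \<Longrightarrow> S r s 0 (\<lambda>_. c) \<noteq> S r s 0 (\<lambda>_. a)"
begin

definition order_interval :: "(int ^ 'n \<Rightarrow> real) set" where
  "order_interval = {u \<in> Lam p. \<forall>i. a \<le> u i \<and> u i \<le> b}"

text \<open>The interval is a closed subset of a product of compact intervals. On periodic functions the
  product topology agrees with that of the norm.\<close>

lemma compact_order_interval: "compact order_interval"
proof -
  have "order_interval = Lam p \<inter> PiE UNIV (\<lambda>_. {a..b})"
    by (auto simp: order_interval_def PiE_UNIV_domain)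
  moreover have "compact (PiE UNIV (\<lambda>_ :: int ^ 'n. {a..b}))"
    using compactin_PiE[of "\<lambda>_ :: int ^ 'n. euclideanreal" UNIV "\<lambda>_. {a..b}"]
    by (simp add: euclidean_product_topology)
  ultimately show ?thesis by (simp add: closed_Lam closed_Int_compact)
qed

lemma const_in_Lam: "(\<lambda>_. c) \<in> Lam p"
  by (simp add: Lam_def)

lemma const_in_order_interval: "a \<le> c \<Longrightarrow> c \<le> b \<Longrightarrow> (\<lambda>_. c) \<in> order_interval"
  by (simp add: order_interval_def const_in_Lam)

lemma J_const: "J (\<lambda>_. c) = real (card (T0 p)) * S r s 0 (\<lambda>_. c)"
proof -
  have "J (\<lambda>_. c) = (\<Sum>j\<in>T0 p. S r s 0 (\<lambda>_. c))"
    unfolding J0_def by (intro sum.cong refl) (simp add: S_def)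
  then show ?thesis by simp
qed

lemma card_T0_pos: "card (T0 p) > 0"
  using zero_in_T0 finite_T0 by (auto simp: card_gt_0_iff)

lemma gradient_const:
  assumes min: "\<And>c'. S r s 0 (\<lambda>_. c) \<le> S r s 0 (\<lambda>_. c')"
  shows "E i (\<lambda>_. c) = 0"
proof -
  have "((\<lambda>t. S r s 0 (\<lambda>_. c + t * 1)) has_real_derivative
      (\<Sum>k\<in>B r. partial k s (window r 0 (\<lambda>_. c + 0 * 1)) * 1)) (at 0)"
    by (rule S_has_derivative)
  then have "(\<Sum>k\<in>B r. partial k s (window r 0 (\<lambda>_. c + 0 * 1)) * 1) = 0"
    by (rule DERIV_local_min[of _ _ _ 1]) (use min in simp_all)
  moreover have "window r (i - k) (\<lambda>_. c) = window r 0 (\<lambda>_. c)" for k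
    by (simp add: window_def)
  ultimately show ?thesis by (simp add: gradient_def)
qed

lemma gradient_a: "E i (\<lambda>_. a) = 0"
  by (rule gradient_const[OF min_a])

lemma gradient_b: "E i (\<lambda>_. b) = 0"
  by (rule gradient_const) (simp add: min_b min_a)

lemma descend_ends: "descend (\<lambda>_. a) = (\<lambda>_. a)" "descend (\<lambda>_. b) = (\<lambda>_. b)"
  by (simp_all add: descend_def gradient_a gradient_b)

text \<open>The constant functions \<open>a\<close> and \<open>b\<close> are fixed by the monotone map \<open>descend\<close>.\<close>

lemma descend_in_order_interval:
  assumes "u \<in> order_interval" shows "descend u \<in> order_interval"
proof -
  have "descend (\<lambda>_. a) i \<le> descend u i" "descend u i \<le> descend (\<lambda>_. b) i" for i
    using assms by (auto intro!: descend_mono simp: order_interval_def)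
  then show ?thesis using assms by (simp add: order_interval_def descend_Lam descend_ends)
qed

text \<open>The interval may be left by other variations, but not by a descent step, which would lower the
  energy.\<close>

lemma minimizer_critical:
  assumes u: "u \<in> order_interval" and min: "\<And>v. v \<in> order_interval \<Longrightarrow> J u \<le> J v"
  shows "E i u = 0"
proof (rule gradient_eq_0)
  show Lam: "u \<in> Lam p" using u by (simp add: order_interval_def)
  have "J u \<le> J u - step_size / 2 * grad_sq u"
    using min[OF descend_in_order_interval[OF u]] descend_decreases[OF Lam] by simp
  then have "step_size * grad_sq u \<le> 0" by simp
  then show "grad_sq u = 0"
    using step_size_pos grad_sq_nonneg[of u] by (simp add: mult_le_0_iff)
qed

text \<open>The maximum \<open>M\<close> of \<open>u\<close> and its translate \<open>v\<close> is again a minimizer by submodularity. If \<open>M\<close> touches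
  \<open>u\<close>, both agree and \<open>v \<le> u\<close>; otherwise \<open>u < v\<close> everywhere. As \<open>u\<close> and \<open>v\<close> have the same sum over
  the period cell, only \<open>u = v\<close> is possible.\<close>

lemma minimizer_const:
  assumes u: "u \<in> order_interval" and min: "\<And>v. v \<in> order_interval \<Longrightarrow> J u \<le> J v"
  shows "\<exists>c. u = (\<lambda>_. c)"
proof -
  have Lam: "u \<in> Lam p" using u by (simp add: order_interval_def)
  have crit_u: "E i u = 0" for i
    by (rule minimizer_critical[OF u]) (rule min)
  have shift: "u (i + k) = u i" for i k
  proof -
    define v where "v = (\<lambda>i. u (i + k))"
    define M where "M = (\<lambda>i. max (u i) (v i))"
    have v: "v \<in> Lam p" unfolding v_def by (rule Lam_translate[OF Lam])
    have M: "M \<in> order_interval" and m: "(\<lambda>i. min (u i) (v i)) \<in> order_interval"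
      using u v by (auto simp: order_interval_def Lam_def M_def v_def max_def min_def)
    have "J M + J (\<lambda>i. min (u i) (v i)) \<le> J u + J v" unfolding M_def by (rule J_submodular)
    moreover have "J v = J u" unfolding v_def by (rule J_translate[OF Lam])
    ultimately have "J M \<le> J u" using min[OF m] by simp
    then have crit_M: "E i M = 0" for i
      using min by (intro minimizer_critical[OF M]) (meson order_trans)
    have le: "u i \<le> M i" for i by (simp add: M_def)
    have sum: "(\<Sum>i\<in>T0 p. v i) = (\<Sum>i\<in>T0 p. u i)"
      unfolding v_def by (rule sum_T0_shift[OF p Lam])
    have "\<exists>i. u i = M i"
    proof (rule ccontr)
      assume "\<not> ?thesis"
      then have ne: "M i \<noteq> u i" for i by metis
      have "u i < v i" for i
        using ne[of i] by (simp add: M_def max_def not_le split: if_splits)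
      then have "(\<Sum>i\<in>T0 p. u i) < (\<Sum>i\<in>T0 p. v i)"
        by (intro sum_strict_mono finite_T0) (use zero_in_T0 in blast)
      with sum show False by simp
    qed
    then obtain j where "u j = M j" by blast
    then have "u = M" by (rule strong_comparison[where u = u and v = M, OF le crit_u crit_M])
    then have M_eq: "M i = u i" for i by (rule fun_cong[OF sym])
    have v_le: "v i \<le> u i" for i
      unfolding M_eq[symmetric] by (simp add: M_def)
    have "v i = u i" if "i \<in> T0 p" for i
    proof (rule ccontr)
      assume "v i \<noteq> u i"
      then have "v i < u i" using v_le[of i] by simp
      then have "(\<Sum>i\<in>T0 p. v i) < (\<Sum>i\<in>T0 p. u i)"
        by (intro sum_strict_mono_ex1 finite_T0) (use that v_le in blast)+
      with sum show False by simp
    qed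
    then have "v = u" by (rule Lam_eqI[OF v Lam])
    then have "v i = u i" by (rule fun_cong)
    then show ?thesis unfolding v_def .
  qed
  have "u i = u 0" for i using shift[of 0 i] by simp
  then show ?thesis by blast
qed

lemma minimizer_ends:
  assumes u: "u \<in> order_interval" and min: "\<And>v. v \<in> order_interval \<Longrightarrow> J u \<le> J v"
  shows "u = (\<lambda>_. a) \<or> u = (\<lambda>_. b)"
proof -
  obtain c where c: "u = (\<lambda>_. c)" using minimizer_const[OF assms] by blast
  have range: "a \<le> c" "c \<le> b" using u by (auto simp: order_interval_def c)
  have "J u \<le> J (\<lambda>_. a)" using ab by (intro min const_in_order_interval) auto
  then have "S r s 0 (\<lambda>_. c) = S r s 0 (\<lambda>_. a)"
    using card_T0_pos min_a[of c] by (simp add: c J_const)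
  with gap[of c] range c show ?thesis by (cases "c = a"; cases "c = b") auto
qed

lemma J_b: "J (\<lambda>_. b) = J (\<lambda>_. a)"
  by (simp add: J_const min_b)

lemma J_a_less:
  assumes u: "u \<in> order_interval" and "u \<noteq> (\<lambda>_. a)" "u \<noteq> (\<lambda>_. b)"
  shows "J (\<lambda>_. a) < J u"
proof -
  have "order_interval \<noteq> {}" using u by auto
  then obtain m where m: "m \<in> order_interval" "\<And>v. v \<in> order_interval \<Longrightarrow> J m \<le> J v"
    using continuous_attains_inf[OF compact_order_interval _ continuous_on_J] by blast
  then have "J m = J (\<lambda>_. a)" using minimizer_ends[OF m] J_b by auto
  moreover have "\<not> (\<forall>v\<in>order_interval. J u \<le> J v)" using minimizer_ends[OF u] assms(2,3) by blast
  ultimately show ?thesis using m(2) by (metis not_le order_trans)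
qed

section \<open>The mountain pass\<close>

definition paths :: "(real \<Rightarrow> int ^ 'n \<Rightarrow> real) set" where
  "paths = {h. continuous_on {0..1} h \<and> h ` {0..1} \<subseteq> order_interval \<and> h 0 = (\<lambda>_. a) \<and> h 1 = (\<lambda>_. b)}"

lemma segment_in_paths: "(\<lambda>\<theta> _. (1 - \<theta>) * a + \<theta> * b) \<in> paths"
proof -
  have "a \<le> (1 - \<theta>) * a + \<theta> * b \<and> (1 - \<theta>) * a + \<theta> * b \<le> b" if "0 \<le> \<theta>" "\<theta> \<le> 1" for \<theta>
  proof -
    have "0 \<le> \<theta> * (b - a)" "0 \<le> (1 - \<theta>) * (b - a)" using that ab by auto
    then show ?thesis by (simp add: algebra_simps)
  qed
  then show ?thesis
    by (auto simp: paths_def intro!: const_in_order_interval continuous_on_coordinatewise_then_product continuous_intros)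
qed

text \<open>The slice at the midpoint contains neither of the two minimizers, and it is compact.\<close>

lemma J_on_slice: "\<exists>\<mu>>J (\<lambda>_. a). \<forall>u\<in>order_interval. u 0 = (a + b) / 2 \<longrightarrow> \<mu> \<le> J u"
proof -
  define A where "A = order_interval \<inter> {u. u 0 = (a + b) / 2}"
  have "closed {u :: int ^ 'n \<Rightarrow> real. u 0 = (a + b) / 2}"
    by (intro closed_Collect_eq continuous_on_product_coordinates continuous_on_const)
  then have "compact A" unfolding A_def by (rule compact_Int_closed[OF compact_order_interval])
  moreover have "(\<lambda>_. (a + b) / 2) \<in> A" using ab by (auto simp: A_def intro!: const_in_order_interval)
  ultimately obtain m where m: "m \<in> A" "\<And>v. v \<in> A \<Longrightarrow> J m \<le> J v"
    using continuous_attains_inf[OF _ _ continuous_on_J, of A] by blast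
  have "m \<in> order_interval" "m 0 = (a + b) / 2" using m(1) by (simp_all add: A_def)
  then have "J (\<lambda>_. a) < J m" using ab by (intro J_a_less) auto
  with m(2) show ?thesis by (auto simp: A_def)
qed

text \<open>By the intermediate value theorem every path meets the slice.\<close>

lemma mountain_pass_level: "J (\<lambda>_. a) < (INF h\<in>paths. SUP \<theta>\<in>{0..1}. J (h \<theta>))"
proof -
  obtain \<mu> where \<mu>: "\<mu> > J (\<lambda>_. a)" and slice: "\<And>u. u \<in> order_interval \<Longrightarrow> u 0 = (a + b) / 2 \<Longrightarrow> \<mu> \<le> J u"
    using J_on_slice by blast
  have "\<mu> \<le> (INF h\<in>paths. SUP \<theta>\<in>{0..1}. J (h \<theta>))"
  proof (rule cINF_greatest)
    show "paths \<noteq> {}" using segment_in_paths by blast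
    fix h assume h: "h \<in> paths"
    then have cont: "continuous_on {0..1} (\<lambda>\<theta>. h \<theta> 0)"
      unfolding paths_def by (blast intro: continuous_on_product_then_coordinatewise)
    have "\<exists>\<theta>. 0 \<le> \<theta> \<and> \<theta> \<le> 1 \<and> h \<theta> 0 = (a + b) / 2"
      by (rule IVT'[OF _ _ _ cont]) (use h ab in \<open>auto simp: paths_def\<close>)
    then obtain \<theta> where \<theta>: "\<theta> \<in> {0..1}" "h \<theta> 0 = (a + b) / 2" by auto
    then have "\<mu> \<le> J (h \<theta>)" using h by (intro slice) (auto simp: paths_def)
    also have "\<dots> \<le> (SUP \<theta>\<in>{0..1}. J (h \<theta>))"
    proof (rule cSUP_upper[OF \<theta>(1)])
      have "continuous_on {0..1} (\<lambda>\<theta>. J (h \<theta>))"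
        using h by (intro continuous_on_compose2[OF continuous_on_J[of UNIV]]) (auto simp: paths_def)
      then show "bdd_above ((\<lambda>\<theta>. J (h \<theta>)) ` {0..1})"
        by (intro bounded_imp_bdd_above compact_imp_bounded compact_continuous_image compact_Icc)
    qed
    finally show "\<mu> \<le> (SUP \<theta>\<in>{0..1}. J (h \<theta>))" .
  qed
  with \<mu> show ?thesis by simp
qed

lemma mountain_pass:
  "\<exists>u\<in>order_interval. J u = (INF h\<in>paths. SUP \<theta>\<in>{0..1}. J (h \<theta>)) \<and> (\<forall>i. E i u = 0) \<and> (\<forall>i. a < u i \<and> u i < b)"
proof -
  have "\<exists>u\<in>order_interval. J u = (INF h\<in>paths. SUP \<theta>\<in>{0..1}. J (h \<theta>)) \<and> step_size / 2 * grad_sq u = 0"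
    unfolding paths_def
  proof (rule minimax_critical_point[where D = descend])
    show "continuous_on order_interval (\<lambda>u. step_size / 2 * grad_sq u)" by (intro continuous_intros continuous_on_grad_sq)
    show "step_size / 2 * grad_sq u \<ge> 0" for u using step_size_pos grad_sq_nonneg by simp
    show "J (descend u) \<le> J u - step_size / 2 * grad_sq u" if "u \<in> order_interval" for u
      using that by (intro descend_decreases) (simp add: order_interval_def)
    show "{h :: real \<Rightarrow> int ^ 'n \<Rightarrow> real. continuous_on {0..1} h \<and> h ` {0..1} \<subseteq> order_interval \<and>
        h 0 = (\<lambda>_. a) \<and> h 1 = (\<lambda>_. b)} \<noteq> {}"
      using segment_in_paths unfolding paths_def by blast
  qed (auto simp: compact_order_interval continuous_on_J continuous_on_descend descend_ends descend_in_order_interval)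
  then obtain u where u: "u \<in> order_interval" and level: "J u = (INF h\<in>paths. SUP \<theta>\<in>{0..1}. J (h \<theta>))"
    and "step_size / 2 * grad_sq u = 0" by (elim bexE conjE)
  then have "grad_sq u = 0" using step_size_pos by simp
  have Lam: "u \<in> Lam p" and le: "a \<le> u i" "u i \<le> b" for i using u by (simp_all add: order_interval_def)
  have crit: "E i u = 0" for i by (rule gradient_eq_0[OF Lam \<open>grad_sq u = 0\<close>])
  have "J (\<lambda>_. a) < J u" unfolding level by (rule mountain_pass_level)
  then have ne: "u \<noteq> (\<lambda>_. a)" "u \<noteq> (\<lambda>_. b)" using J_b by (metis less_irrefl)+
  have strict: "a < u i \<and> u i < b" for i
  proof -
    have "a \<noteq> u i"
    proof
      assume "a = u i"
      then have "(\<lambda>_. a) = u"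
        by (rule strong_comparison[where u = "\<lambda>_. a" and v = u, OF le(1) gradient_a crit])
      with ne(1) show False by simp
    qed
    moreover have "u i \<noteq> b"
    proof
      assume "u i = b"
      then have "u = (\<lambda>_. b)"
        by (rule strong_comparison[where u = u and v = "\<lambda>_. b", OF le(2) crit gradient_b])
      with ne(2) show False by simp
    qed
    ultimately show ?thesis using le[of i] by simp
  qed
  from u level crit strict show ?thesis by blast
qed

end

section \<open>The norm topology on periodic functions\<close>

lemma Lam_diff: "u \<in> Lam p \<Longrightarrow> v \<in> Lam p \<Longrightarrow> (\<lambda>i. u i - v i) \<in> Lam p"
  by (simp add: Lam_def)

context periodic_interaction
begin

lemma Lam_metric: "Metric_space (Lam p) (\<lambda>u v. Lam_norm p (\<lambda>i. u i - v i))"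
proof
  fix u v :: "int ^ 'n \<Rightarrow> real"
  show "0 \<le> Lam_norm p (\<lambda>i. u i - v i)" by (simp add: Lam_norm_def)
  show "Lam_norm p (\<lambda>i. u i - v i) = Lam_norm p (\<lambda>i. v i - u i)"
    by (simp add: Lam_norm_def L2_set_def power2_commute)
next
  fix u v :: "int ^ 'n \<Rightarrow> real" assume u: "u \<in> Lam p" and v: "v \<in> Lam p"
  have "u = v" if "Lam_norm p (\<lambda>i. u i - v i) = 0"
    using that by (intro Lam_eqI[OF u v]) (simp add: Lam_norm_def L2_set_eq_0_iff finite_T0)
  then show "Lam_norm p (\<lambda>i. u i - v i) = 0 \<longleftrightarrow> u = v"
    by (auto simp: Lam_norm_def L2_set_def)
next
  fix u v w :: "int ^ 'n \<Rightarrow> real"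
  show "Lam_norm p (\<lambda>i. u i - w i) \<le> Lam_norm p (\<lambda>i. u i - v i) + Lam_norm p (\<lambda>i. v i - w i)"
    using L2_set_triangle_ineq[of "\<lambda>i. u i - v i" "\<lambda>i. v i - w i" "T0 p"]
    by (simp add: Lam_norm_def)
qed

text \<open>A periodic function is determined by its finitely many values on the period cell, so convergence
  in norm is convergence at every site.\<close>

lemma continuous_map_Lam_topology_iff:
  fixes h :: "real \<Rightarrow> int ^ 'n \<Rightarrow> real"
  assumes Lam: "\<And>\<theta>. \<theta> \<in> A \<Longrightarrow> h \<theta> \<in> Lam p"
  shows "continuous_map (top_of_set A) (Lam_topology p) h \<longleftrightarrow> continuous_on A h"
proof -
  interpret M: Metric_space "Lam p" "\<lambda>u v. Lam_norm p (\<lambda>i. u i - v i)" by (rule Lam_metric)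
  have top: "Lam_topology p = M.mtopology" by (simp add: Lam_topology_def)
  show ?thesis
  proof
    assume h: "continuous_map (top_of_set A) (Lam_topology p) h"
    show "continuous_on A h"
    proof (rule continuous_on_coordinatewise_then_product)
      fix i
      have "continuous_map (top_of_set A) Met_TC.mtopology (\<lambda>\<theta>. h \<theta> i)"
        unfolding Met_TC.continuous_map_to_metric
      proof (intro ballI allI impI)
        fix x \<epsilon> assume "x \<in> topspace (top_of_set A)" and "(0::real) < \<epsilon>"
        with h obtain U where U: "openin (top_of_set A) U" "x \<in> U" "\<forall>y\<in>U. h y \<in> M.mball (h x) \<epsilon>"
          unfolding top M.continuous_map_to_metric by blast
        have "\<bar>h x i - h y i\<bar> < \<epsilon>" if "y \<in> U" for y
        proof -
          have "h x \<in> Lam p" "h y \<in> Lam p" "Lam_norm p (\<lambda>i. h x i - h y i) < \<epsilon>"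
            using U(3) that by (auto simp: M.in_mball)
          then show ?thesis using Lam_norm_ge[OF Lam_diff, of "h x" "h y" i] by simp
        qed
        with U show "\<exists>U. openin (top_of_set A) U \<and> x \<in> U \<and> (\<forall>y\<in>U. h y i \<in> Met_TC.mball (h x i) \<epsilon>)"
          by (intro exI[of _ U]) (auto simp: dist_real_def)
      qed
      then show "continuous_on A (\<lambda>\<theta>. h \<theta> i)" by simp
    qed
  next
    assume h: "continuous_on A h"
    have coord: "continuous_on A (\<lambda>\<theta>. h \<theta> i)" for i
      by (rule continuous_on_product_then_coordinatewise[OF h])
    show "continuous_map (top_of_set A) (Lam_topology p) h"
      unfolding top M.continuous_map_to_metric
    proof (intro ballI allI impI)
      fix x and \<epsilon> :: real assume "x \<in> topspace (top_of_set A)" and \<epsilon>: "0 < \<epsilon>"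
      then have x: "x \<in> A" by simp
      let ?d = "\<lambda>y. Lam_norm p (\<lambda>i. h x i - h y i)"
      have "continuous_on A ?d"
        unfolding Lam_norm_def L2_set_def by (intro continuous_intros coord)
      then have "openin (top_of_set A) (A \<inter> ?d -` {..<\<epsilon>})"
        by (rule continuous_openin_preimage_gen) simp
      moreover have "?d x = 0" by (simp add: Lam_norm_def L2_set_def)
      ultimately show "\<exists>U. openin (top_of_set A) U \<and> x \<in> U \<and> (\<forall>y\<in>U. h y \<in> M.mball (h x) \<epsilon>)"
        using x \<epsilon> Lam by (intro exI[of _ "A \<inter> ?d -` {..<\<epsilon>}"]) (auto simp: M.in_mball)
    qed
  qed
qed

end

section \<open>The critical point at the minimax level\<close>

lemma (in adjacent_minima) H0_shift:
  "h \<in> H0 (\<lambda>_. a) (\<lambda>_. b) p \<longleftrightarrow> (\<lambda>\<theta> i. h \<theta> i + a) \<in> paths"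
proof -
  let ?g = "\<lambda>\<theta> i. h \<theta> i + a"
  have G0: "u \<in> G0 (\<lambda>_. a) (\<lambda>_. b) p \<longleftrightarrow> (\<lambda>i. u i + a) \<in> order_interval" for u
    by (auto simp: G0_def order_interval_def Lam_def algebra_simps)
  have cont: "continuous_on {0..1} ?g \<longleftrightarrow> continuous_on {0..1} h"
  proof -
    have "continuous_on {0..1} (\<lambda>\<theta>. h \<theta> i + a) \<longleftrightarrow> continuous_on {0..1} (\<lambda>\<theta>. h \<theta> i)" for i
      using continuous_on_add[of "{0..1}" "\<lambda>\<theta>. h \<theta> i + a" "\<lambda>_. - a"]
        continuous_on_add[of "{0..1}" "\<lambda>\<theta>. h \<theta> i" "\<lambda>_. a"] by auto
    moreover have "continuous_on {0..1} f \<longleftrightarrow> (\<forall>i. continuous_on {0..1} (\<lambda>\<theta>. f \<theta> i))"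
      for f :: "real \<Rightarrow> int ^ 'n \<Rightarrow> real"
      by (intro iffI allI continuous_on_coordinatewise_then_product)
         (rule continuous_on_product_then_coordinatewise, auto)
    ultimately show ?thesis by (simp only:)
  qed
  have map: "continuous_map (top_of_set {0..1}) (Lam_topology p) h \<longleftrightarrow> continuous_on {0..1} h"
    if "h ` {0..1} \<subseteq> G0 (\<lambda>_. a) (\<lambda>_. b) p"
    using that by (intro continuous_map_Lam_topology_iff) (force simp: G0_def)
  have image: "?g ` {0..1} \<subseteq> order_interval \<longleftrightarrow> h ` {0..1} \<subseteq> G0 (\<lambda>_. a) (\<lambda>_. b) p"
    by (simp add: image_subset_iff G0)
  have "continuous_map (top_of_set {0..1}) (subtopology (Lam_topology p) (G0 (\<lambda>_. a) (\<lambda>_. b) p)) h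
      \<longleftrightarrow> continuous_on {0..1} ?g \<and> ?g ` {0..1} \<subseteq> order_interval"
    unfolding continuous_map_in_subtopology topspace_euclidean_subtopology
      image_subset_iff_funcset[symmetric] cont image
    using map by blast
  moreover have "h 0 = (\<lambda>_. 0) \<longleftrightarrow> ?g 0 = (\<lambda>_. a)" "h 1 = (\<lambda>_. b - a) \<longleftrightarrow> ?g 1 = (\<lambda>_. b)"
    by (auto simp: fun_eq_iff algebra_simps)
  ultimately show ?thesis unfolding H0_def paths_def by simp
qed

lemma (in adjacent_minima) d0_eq:
  "d0 r s (\<lambda>_. a) (\<lambda>_. b) p = (INF h\<in>paths. SUP \<theta>\<in>{0..1}. J (h \<theta>))"
proof -
  have "paths = (\<lambda>h \<theta> i. h \<theta> i + a) ` H0 (\<lambda>_. a) (\<lambda>_. b) p"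
  proof (intro equalityI subsetI)
    fix g assume "g \<in> paths"
    then have "(\<lambda>\<theta> i. g \<theta> i - a) \<in> H0 (\<lambda>_. a) (\<lambda>_. b) p" by (simp add: H0_shift)
    then show "g \<in> (\<lambda>h \<theta> i. h \<theta> i + a) ` H0 (\<lambda>_. a) (\<lambda>_. b) p"
      by (rule rev_image_eqI) simp
  qed (auto simp: H0_shift)
  then show ?thesis by (simp add: d0_def I0_def image_image)
qed

theorem theorem3p6:
  fixes s :: "(int ^ 'n \<Rightarrow> real) \<Rightarrow> real" and r :: nat
    and v0 w0 :: "int ^ 'n \<Rightarrow> real" and p :: "nat ^ 'n"
  assumes r: "r \<ge> 1"
    and C2: "C2_on (B r) s"
    and S1: "cond_S1 r s" and S2: "cond_S2 r s" and S3: "cond_S3 r s" and S4: "cond_S4 r s"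
    and v0: "v0 \<in> M0 r s" and w0: "w0 \<in> M0 r s" and less: "v0 \<lless> w0"
    and adjacent: "\<not> (\<exists>u\<in>M0 r s. v0 \<lless> u \<and> u \<lless> w0)"
    and p: "\<And>j. p $ j \<ge> 1"
  shows "\<exists>u. critical_point p (I0 r s v0 p) u \<and>
             I0 r s v0 p u = d0 r s v0 w0 p \<and>
             (\<lambda>_. 0) \<lless> u \<and> u \<lless> (\<lambda>i. w0 i - v0 i) \<and>
             solution r s (\<lambda>i. u i + v0 i)"
proof -
  obtain a b where a: "v0 = (\<lambda>_. a)" "S r s 0 (\<lambda>_. a) = c0 r s"
    and b: "w0 = (\<lambda>_. b)" "S r s 0 (\<lambda>_. b) = c0 r s"
    using v0 w0 by (auto simp: M0_def)
  obtain C where C: "\<And>u i k. u \<in> extensional (B r) \<Longrightarrow> i \<in> B r \<Longrightarrow> k \<in> B r \<Longrightarrow> \<bar>partial2 i k s u\<bar> \<le> C"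
    using S4 unfolding cond_S4_def by blast
  have bdd: "bdd_below (s ` extensional (B r))" using S2 by (simp add: cond_S2_def)
  then have bdd_S: "bdd_below (range (\<lambda>c. S r s 0 (\<lambda>_. c)))"
    by (rule bdd_below_mono) (auto simp: S_window window_extensional)
  \<comment> \<open>The bound is enlarged to a positive one, as the step size has it in the denominator.\<close>
  interpret adjacent_minima r s "max C 1" p a b
  proof
    show "\<bar>partial2 i k s y\<bar> \<le> max C 1" if "y \<in> extensional (B r)" "i \<in> B r" "k \<in> B r" for y i k
      using C[OF that] by simp
    show "a < b" using less by (simp add: below_def a b)
    show "S r s 0 (\<lambda>_. a) \<le> S r s 0 (\<lambda>_. c)" for c
      unfolding a(2) c0_def by (rule cINF_lower[OF bdd_S]) simp
    show "S r s 0 (\<lambda>_. c) \<noteq> S r s 0 (\<lambda>_. a)" if "a < c" "c < b" for c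
      using adjacent that a by (auto simp: M0_def below_def b(1))
  qed (use r C2 S3 p a(2) b(2) in simp_all)
  obtain U where U: "U \<in> order_interval" and level: "J U = d0 r s v0 w0 p"
    and crit: "\<And>i. E i U = 0" and strict: "\<And>i. a < U i \<and> U i < b"
    using mountain_pass unfolding a(1) b(1) d0_eq by blast
  define u where "u = (\<lambda>i. U i - a)"
  have U_eq: "(\<lambda>i. u i + v0 i) = U" by (simp add: u_def a)
  have "u \<in> Lam p" using U by (simp add: u_def order_interval_def Lam_def)
  then have "critical_point p (I0 r s v0 p) u"
    by (rule critical_pointI) (simp_all add: a(1) const_in_Lam crit U_eq[unfolded a(1)])
  moreover have "I0 r s v0 p u = d0 r s v0 w0 p" using level by (simp add: I0_def U_eq)
  moreover have "(\<lambda>_. 0) \<lless> u" "u \<lless> (\<lambda>i. w0 i - v0 i)"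
    using strict by (auto simp: below_def u_def a b)
  moreover have "solution r s (\<lambda>i. u i + v0 i)"
    unfolding solution_iff_gradient U_eq using crit by blast
  ultimately show ?thesis by blast
qed

end
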